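(* Let $\tau_3(n)$ denote the maximum number of rainbow triangles in an almost $3$-Gallai colouring of $E(K_n)$. Then \[ \left(\tfrac{1}{2} - o(1)\right) n \log n \le \tau_3(n) \le O\big(n^{\sqrt{2}} \log n\big). \] Moreover, the lower bound is attained by almost $3$-Gallai colourings of $E(K_n)$ that use only three colours.
   Context: A colouring $c : E(K_n) \to \mathbb{N}$ of the edges of $K_n$ is almost $3$-Gallai if no two rainbow triangles share an edge, where a triangle is rainbow if its three edges have pairwise distinct colours. All logarithms are in base $2$. *)

theory Defs
  imports Complex_Main "HOL-Library.Landau_Symbols"
begin

text \<open>Edges of K_n on vertex set {0..<n}; a colouring is c :: nat set => nat
  (only its values on edges matter).\<close>

definition Kn_edges :: "nat \<Rightarrow> nat set set" where
  "Kn_edges n = {e. \<exists>a b. a < n \<and> b < n \<and> a \<noteq> b \<and> e = {a, b}}"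

definition rainbow_triangle :: "nat \<Rightarrow> (nat set \<Rightarrow> nat) \<Rightarrow> nat set \<Rightarrow> bool" where
  "rainbow_triangle n c T \<longleftrightarrow>
     (\<exists>a b d. a < n \<and> b < n \<and> d < n \<and> a \<noteq> b \<and> a \<noteq> d \<and> b \<noteq> d \<and> T = {a, b, d} \<and>
        c {a, b} \<noteq> c {a, d} \<and> c {a, b} \<noteq> c {b, d} \<and> c {a, d} \<noteq> c {b, d})"

definition rainbow_triangles :: "nat \<Rightarrow> (nat set \<Rightarrow> nat) \<Rightarrow> nat set set" where
  "rainbow_triangles n c = {T. rainbow_triangle n c T}"

text \<open>Almost 3-Gallai: no two (distinct) rainbow triangles share an edge,
  i.e. share two vertices.\<close>
definition almost_3_gallai :: "nat \<Rightarrow> (nat set \<Rightarrow> nat) \<Rightarrow> bool" where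
  "almost_3_gallai n c \<longleftrightarrow>
     (\<forall>T1 T2. rainbow_triangle n c T1 \<longrightarrow> rainbow_triangle n c T2 \<longrightarrow> T1 \<noteq> T2
        \<longrightarrow> card (T1 \<inter> T2) \<le> 1)"

definition tau3 :: "nat \<Rightarrow> nat" where
  "tau3 n = Max {card (rainbow_triangles n c) | c. almost_3_gallai n c}"

end

theory Submission
  imports Defs "HOL-Real_Asymp.Real_Asymp"
begin

text \<open>
  Lower bound. Take a discrete cube together with one extra vertex for each coordinate. Cube edges
  get colour 3, the extra vertex of coordinate i sees a cube point in colour 1 or 2 according to the
  i-th bit, and everything else gets colour 1. The rainbow triangles are exactly the cube edges of
  direction i together with the i-th extra vertex, so there are about (n log n)/2 of them and no two
  share an edge.

  Upper bound. Merging colours at random into three classes keeps a constant fraction of the rainbow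
  triangles and creates none, so three colours suffice; we show that a set of m vertices then spans at
  most O(m powr 1.4) rainbow triangles, by induction on m. A vertex v splits the other vertices
  into three colour neighbourhoods; up to a matching, an edge between two of them carries one of their
  two colours, and this forces only O(m log m) rainbow triangles to meet more than one neighbourhood.
  If some v splits the vertices into two parts that are not too unbalanced, the induction hypothesis
  applies to the parts. Otherwise every vertex sees all but at most \<open>\<sigma>\<close> vertices in one colour a. Grouping
  the vertices by this colour, either every vertex of a group lies opposite the colour a in few
  rainbow triangles, or there is a set A which lies in few rainbow triangles per vertex and can be
  removed: it is contained in a neighbourhood of some v, and the vertices that A does not see in
  colour a form a set of size O(\<open>\<sigma>\<close>).
\<close>

subsection \<open>Sampling, matching cuts and edge-disjoint triples\<close>

lemma card_supersets_avoiding: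
  assumes "finite U" "I \<subseteq> U" "O' \<subseteq> U" "I \<inter> O' = {}"
  shows "2 ^ (card I + card O') * card {R. R \<subseteq> U \<and> I \<subseteq> R \<and> O' \<inter> R = {}} = 2 ^ card U"
proof -
  have "bij_betw (\<lambda>Q. Q \<union> I) (Pow (U - (I \<union> O'))) {R. R \<subseteq> U \<and> I \<subseteq> R \<and> O' \<inter> R = {}}"
    by (rule bij_betw_byWitness[where f' = "\<lambda>R. R - I"]) (use assms in auto)
  then have "card {R. R \<subseteq> U \<and> I \<subseteq> R \<and> O' \<inter> R = {}} = 2 ^ card (U - (I \<union> O'))"
    using assms by (simp add: card_Pow flip: bij_betw_same_card)
  moreover have "card (I \<union> O') = card I + card O'"
    using assms by (meson card_Un_disjoint finite_subset)
  moreover have "card (I \<union> O') \<le> card U" using assms by (intro card_mono) auto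
  moreover have "card (U - (I \<union> O')) = card U - card (I \<union> O')"
    using assms by (intro card_Diff_subset) (auto intro: finite_subset)
  ultimately show ?thesis by (simp add: power_add [symmetric])
qed

text \<open>Averaging over all subsets \<open>R\<close> of \<open>U\<close>: a uniformly random one
  contains \<open>I t\<close> and misses \<open>O' t\<close> with probability at least
  \<open>1 / 2 ^ r\<close>, so the mean number of surviving \<open>t\<close> is at least
  \<open>card F / 2 ^ r\<close>, and some \<open>R\<close> reaches the mean.\<close>

lemma exists_good_sample:
  fixes I O' :: "'t \<Rightarrow> 'u set"
  assumes "finite F" "finite U"
    and sub: "\<And>t. t \<in> F \<Longrightarrow> I t \<subseteq> U \<and> O' t \<subseteq> U \<and> I t \<inter> O' t = {} \<and> card (I t) + card (O' t) \<le> r"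
  shows "\<exists>R. R \<subseteq> U \<and> card F \<le> 2 ^ r * card {t \<in> F. I t \<subseteq> R \<and> O' t \<inter> R = {}}"
proof (rule ccontr)
  assume *: "\<not> ?thesis"
  have lt: "2 ^ r * card {t \<in> F. I t \<subseteq> R \<and> O' t \<inter> R = {}} < card F" if "R \<subseteq> U" for R
    using that * not_le_imp_less by blast
  have "card F * 2 ^ card U = (\<Sum>t\<in>F. 2 ^ card U)" by simp
  also have "\<dots> \<le> (\<Sum>t\<in>F. 2 ^ r * card {R. R \<subseteq> U \<and> I t \<subseteq> R \<and> O' t \<inter> R = {}})"
  proof (rule sum_mono)
    fix t assume t: "t \<in> F"
    have "2 ^ card U = 2 ^ (card (I t) + card (O' t)) * card {R. R \<subseteq> U \<and> I t \<subseteq> R \<and> O' t \<inter> R = {}}"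
      using card_supersets_avoiding[of U "I t" "O' t"] sub[OF t] assms by simp
    also have "\<dots> \<le> 2 ^ r * card {R. R \<subseteq> U \<and> I t \<subseteq> R \<and> O' t \<inter> R = {}}"
      using sub[OF t] by (intro mult_right_mono power_increasing) auto
    finally show "2 ^ card U \<le> 2 ^ r * card {R. R \<subseteq> U \<and> I t \<subseteq> R \<and> O' t \<inter> R = {}}" .
  qed
  also have "\<dots> = 2 ^ r * (\<Sum>t\<in>F. \<Sum>R\<in>Pow U. if I t \<subseteq> R \<and> O' t \<inter> R = {} then 1 else 0)"
  proof -
    have "{R. R \<subseteq> U \<and> I t \<subseteq> R \<and> O' t \<inter> R = {}} = Pow U \<inter> {R. I t \<subseteq> R \<and> O' t \<inter> R = {}}" for t by auto
    then show ?thesis using assms by (simp add: sum_distrib_left sum.If_cases)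
  qed
  also have "\<dots> = 2 ^ r * (\<Sum>R\<in>Pow U. \<Sum>t\<in>F. if I t \<subseteq> R \<and> O' t \<inter> R = {} then 1 else 0)"
    by (subst sum.swap) simp
  also have "\<dots> = (\<Sum>R\<in>Pow U. 2 ^ r * card {t \<in> F. I t \<subseteq> R \<and> O' t \<inter> R = {}})"
    using assms by (simp add: sum_distrib_left sum.If_cases Int_def)
  also have "\<dots> < (\<Sum>R\<in>Pow U. card F)"
    using assms lt by (intro sum_strict_mono) auto
  also have "\<dots> = card F * 2 ^ card U" using assms by (simp add: card_Pow)
  finally show False by simp
qed

section \<open>Graphs whose edges are cut by matchings\<close>

text \<open>The smaller side is at most half of the total, so its logarithm grows by at least 1 on
  merging; this pays for \<open>min a b\<close>.\<close>

lemma log2_merge: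
  fixes a b :: nat
  assumes "1 \<le> a" "1 \<le> b"
  shows "real a * log 2 a + real b * log 2 b + min a b \<le> real (a + b) * log 2 (a + b)"
proof -
  have *: "real a * log 2 a + real b * log 2 b + a \<le> real (a + b) * log 2 (a + b)"
    if "1 \<le> a" "a \<le> b" for a b :: nat
  proof -
    have "log 2 a + 1 = log 2 (2 * a)" using that by (simp add: log_mult)
    also have "\<dots> \<le> log 2 (a + b)" using that by simp
    finally have "real a * (log 2 a + 1) \<le> real a * log 2 (a + b)" by (intro mult_left_mono) auto
    moreover have "real b * log 2 b \<le> real b * log 2 (a + b)" using that by (intro mult_left_mono) auto
    ultimately show ?thesis by (simp add: algebra_simps)
  qed
  show ?thesis
  proof (cases "a \<le> b")
    case True then show ?thesis using *[of a b] assms by simp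
  next
    case False then show ?thesis using *[of b a] assms by (simp add: add.commute min_def)
  qed
qed

definition crosses :: "'a set \<Rightarrow> 'a set \<Rightarrow> bool" where
  "crosses U e \<longleftrightarrow> (\<exists>x y. x \<in> U \<and> y \<notin> U \<and> e = {x, y})"

text \<open>Split \<open>S\<close> along one of the cuts: the matching across it is no larger than the smaller side.\<close>

lemma matching_cuts_bound:
  fixes H :: "'a set set"
  assumes "finite S" "\<And>e. e \<in> H \<Longrightarrow> e \<subseteq> S"
    and "\<And>e. e \<in> H \<Longrightarrow> \<exists>U. crosses U e \<and> pairwise disjnt {f \<in> H. crosses U f}"
    and "\<And>e. e \<in> H \<Longrightarrow> \<exists>x y. e = {x, y}"
  shows "real (card H) \<le> card S * log 2 (card S)"
  using assms
proof (induction "card S" arbitrary: S H rule: less_induct)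
  case less
  show ?case
  proof (cases "H = {}")
    case True
    then show ?thesis by (cases "card S = 0") auto
  next
    case False
    then obtain e where e: "e \<in> H" by auto
    from less.prems(3)[OF e] obtain U
      where U: "crosses U e" and mat: "pairwise disjnt {f \<in> H. crosses U f}" by metis
    have finH: "finite H"
      using less.prems(1,2) by (intro finite_subset[of H "Pow S"]) auto
    have sub: "\<exists>U. crosses U e \<and> pairwise disjnt {f \<in> H'. crosses U f}" if "H' \<subseteq> H" "e \<in> H'" for H' e
    proof -
      have "e \<in> H" using that by auto
      from less.prems(3)[OF this] obtain U where "crosses U e" "pairwise disjnt {f \<in> H. crosses U f}" by metis
      moreover have "{f \<in> H'. crosses U f} \<subseteq> {f \<in> H. crosses U f}" using that by auto
      ultimately show ?thesis using pairwise_mono by blast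
    qed
    define S1 S2 where "S1 = S \<inter> U" and "S2 = S - U"
    define H1 H2 Hc where "H1 = {e \<in> H. e \<subseteq> U}" and "H2 = {e \<in> H. e \<inter> U = {}}" and "Hc = {e \<in> H. crosses U e}"
    have H: "H \<subseteq> H1 \<union> H2 \<union> Hc"
    proof
      fix f assume f: "f \<in> H"
      obtain x y where "f = {x, y}" using less.prems(4)[OF f] by auto
      with f show "f \<in> H1 \<union> H2 \<union> Hc" unfolding H1_def H2_def Hc_def crosses_def
        by (cases "x \<in> U"; cases "y \<in> U") (auto simp: insert_commute)
    qed
    have ne: "S1 \<noteq> {}" "S2 \<noteq> {}" using U less.prems(2)[OF e] unfolding crosses_def S1_def S2_def by auto
    have fin: "finite S1" "finite S2" using less.prems(1) by (auto simp: S1_def S2_def)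
    have cS: "card S = card S1 + card S2"
      unfolding S1_def S2_def by (rule card_Int_Diff[OF less.prems(1)])
    have pos: "card S1 \<ge> 1" "card S2 \<ge> 1" using ne fin by (simp_all add: Suc_le_eq card_gt_0_iff)
    have 1: "real (card H1) \<le> card S1 * log 2 (card S1)"
    proof (rule less.hyps)
      show "card S1 < card S" using pos cS by simp
      show "\<exists>U. crosses U e \<and> pairwise disjnt {f \<in> H1. crosses U f}" if "e \<in> H1" for e
        using that by (intro sub) (auto simp: H1_def)
    qed (use less.prems(2,4) fin in \<open>auto simp: H1_def S1_def\<close>)
    have 2: "real (card H2) \<le> card S2 * log 2 (card S2)"
    proof (rule less.hyps)
      show "card S2 < card S" using pos cS by simp
      show "\<exists>U. crosses U e \<and> pairwise disjnt {f \<in> H2. crosses U f}" if "e \<in> H2" for e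
        using that by (intro sub) (auto simp: H2_def)
    qed (use less.prems(2,4) fin in \<open>auto simp: H2_def S2_def\<close>)
    \<comment> \<open>Distinct edges of \<open>Hc\<close> are disjoint, so picking a point of
      \<open>B\<close> from each is injective. Used with both sides of the cut as
      \<open>B\<close>.\<close>
    have inj: "card Hc \<le> card B" if "finite B" "\<And>f. f \<in> Hc \<Longrightarrow> f \<inter> B \<noteq> {}" for B
    proof -
      have g: "\<forall>f\<in>Hc. (SOME x. x \<in> f \<inter> B) \<in> f \<inter> B" unfolding some_in_eq using that(2) by blast
      have "inj_on (\<lambda>f. SOME x. x \<in> f \<inter> B) Hc"
      proof (rule inj_onI)
        fix f1 f2 assume "f1 \<in> Hc" "f2 \<in> Hc" "(SOME x. x \<in> f1 \<inter> B) = (SOME x. x \<in> f2 \<inter> B)"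
        then have "\<not> disjnt f1 f2" using g by (metis Int_iff disjnt_iff)
        then show "f1 = f2" using mat \<open>f1 \<in> Hc\<close> \<open>f2 \<in> Hc\<close> unfolding Hc_def pairwise_def by blast
      qed
      then show ?thesis using g that(1) by (intro card_inj_on_le[where f = "\<lambda>f. SOME x. x \<in> f \<inter> B"]) auto
    qed
    have c1: "card Hc \<le> card S1"
    proof (rule inj[OF fin(1)])
      fix f assume "f \<in> Hc"
      then show "f \<inter> S1 \<noteq> {}" using less.prems(2)[of f] by (auto simp: Hc_def crosses_def S1_def)
    qed
    have c2: "card Hc \<le> card S2"
    proof (rule inj[OF fin(2)])
      fix f assume "f \<in> Hc"
      then show "f \<inter> S2 \<noteq> {}" using less.prems(2)[of f] by (auto simp: Hc_def crosses_def S2_def)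
    qed
    have "card H \<le> card (H1 \<union> H2 \<union> Hc)" using H finH by (intro card_mono) (auto simp: H1_def H2_def Hc_def)
    also have "\<dots> \<le> card H1 + card H2 + card Hc" by (meson card_Un_le add_le_mono le_refl le_trans)
    finally have "real (card H) \<le> card S1 * log 2 (card S1) + card S2 * log 2 (card S2) + min (card S1) (card S2)"
      using 1 2 c1 c2 by linarith
    also have "\<dots> \<le> card S * log 2 (card S)" using log2_merge[OF pos] cS by simp
    finally show ?thesis .
  qed
qed

section \<open>Edge-disjoint triples in a tripartite graph and in its complement\<close>

text \<open>The relations are read cyclically as the edges of a tripartite graph; two vertices of a
  triangle determine the third.\<close>

definition edge_disjoint_triples ::
  "'a set \<Rightarrow> 'b set \<Rightarrow> 'c set \<Rightarrow> ('a \<Rightarrow> 'b \<Rightarrow> bool) \<Rightarrow> ('b \<Rightarrow> 'c \<Rightarrow> bool) \<Rightarrow> ('c \<Rightarrow> 'a \<Rightarrow> bool) \<Rightarrow> bool" where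
  "edge_disjoint_triples X Y Z p q r \<longleftrightarrow>
    (\<forall>x\<in>X. \<forall>y\<in>Y. \<forall>z\<in>Z. p x y \<and> q y z \<and> r z x \<longrightarrow>
       (\<forall>x'\<in>X. p x' y \<and> r z x' \<longrightarrow> x' = x) \<and>
       (\<forall>y'\<in>Y. p x y' \<and> q y' z \<longrightarrow> y' = y) \<and>
       (\<forall>z'\<in>Z. q y z' \<and> r z' x \<longrightarrow> z' = z))"

definition triples ::
  "'a set \<Rightarrow> 'b set \<Rightarrow> 'c set \<Rightarrow> ('a \<Rightarrow> 'b \<Rightarrow> bool) \<Rightarrow> ('b \<Rightarrow> 'c \<Rightarrow> bool) \<Rightarrow> ('c \<Rightarrow> 'a \<Rightarrow> bool) \<Rightarrow> ('a \<times> 'b \<times> 'c) set" where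
  "triples X Y Z p q r = {(x, y, z). x \<in> X \<and> y \<in> Y \<and> z \<in> Z \<and> p x y \<and> q y z \<and> r z x}"

lemma card_le_one_if_unique: "(\<And>a b. a \<in> B \<Longrightarrow> b \<in> B \<Longrightarrow> a = b) \<Longrightarrow> card B \<le> 1"
  by (metis card_le_Suc0_iff_eq One_nat_def card.infinite zero_le_one)

lemma card_Diff_ge: "card A \<le> card (A - B) + card B" if "finite B"
  using that diff_card_le_card_Diff[of B A] by linarith

lemma ex_distinct_if_card_ge_two:
  assumes "2 \<le> card B" shows "\<exists>a\<in>B. \<exists>b\<in>B. a \<noteq> b"
  using assms card_le_one_if_unique[of B] by fastforce

text \<open>
  If all three vertices of the triple had degree at least 5, one could choose further triples
  \<open>(x1, y1, z)\<close>, \<open>(x2, y, z2)\<close>, \<open>(x, a, b)\<close> and \<open>(x, c, d)\<close> such that both \<open>(x2, y1, b)\<close> and \<open>(x2, y1, d)\<close> are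
  triples of the complementary relations; these share the edge \<open>(x2, y1)\<close>.
\<close>

lemma low_degree_vertex:
  fixes X :: "'a set" and Y :: "'b set" and Z :: "'c set"
  assumes fin: "finite X" "finite Y" "finite Z"
    and P: "edge_disjoint_triples X Y Z p q r"
    and N: "edge_disjoint_triples X Y Z (\<lambda>x y. \<not> p x y) (\<lambda>y z. \<not> q y z) (\<lambda>z x. \<not> r z x)"
    and mem: "(x, y, z) \<in> triples X Y Z p q r"
    and dx: "5 \<le> card {(y', z'). (x, y', z') \<in> triples X Y Z p q r}"
    and dy: "5 \<le> card {(x', z'). (x', y, z') \<in> triples X Y Z p q r}"
    and dz: "5 \<le> card {(x', y'). (x', y', z) \<in> triples X Y Z p q r}"
  shows False
proof -
  let ?T = "triples X Y Z p q r"
  have xyz: "x \<in> X" "y \<in> Y" "z \<in> Z" "p x y" "q y z" "r z x" using mem by (auto simp: triples_def)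
  have TD: "a \<in> X" "b \<in> Y" "d \<in> Z" "p a b" "q b d" "r d a" if "(a, b, d) \<in> ?T" for a b d
    using that by (auto simp: triples_def)
  have Px: "x' = x''" if "x' \<in> X" "x'' \<in> X" "b \<in> Y" "d \<in> Z" "q b d" "p x' b" "r d x'" "p x'' b" "r d x''" for x' x'' b d
    using P that unfolding edge_disjoint_triples_def by blast
  have Py: "y' = y''" if "y' \<in> Y" "y'' \<in> Y" "a \<in> X" "d \<in> Z" "r d a" "p a y'" "q y' d" "p a y''" "q y'' d" for y' y'' a d
    using P that unfolding edge_disjoint_triples_def by blast
  have Pz: "z' = z''" if "z' \<in> Z" "z'' \<in> Z" "a \<in> X" "b \<in> Y" "p a b" "q b z'" "r z' a" "q b z''" "r z'' a" for z' z'' a b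
    using P that unfolding edge_disjoint_triples_def by blast
  have Ny: "y' = y''" if "y' \<in> Y" "y'' \<in> Y" "a \<in> X" "d \<in> Z" "\<not> r d a" "\<not> p a y'" "\<not> q y' d" "\<not> p a y''" "\<not> q y'' d" for y' y'' a d
    using N that unfolding edge_disjoint_triples_def by blast
  have Nz: "z' = z''" if "z' \<in> Z" "z'' \<in> Z" "a \<in> X" "b \<in> Y" "\<not> p a b" "\<not> q b z'" "\<not> r z' a" "\<not> q b z''" "\<not> r z'' a" for z' z'' a b
    using N that unfolding edge_disjoint_triples_def by blast
  define Dx Dy Dz where "Dx = {(y', z'). (x, y', z') \<in> ?T}" and "Dy = {(x', z'). (x', y, z') \<in> ?T}"
    and "Dz = {(x', y'). (x', y', z) \<in> ?T}"
  have fD: "finite Dx" "finite Dy" "finite Dz"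
    using fin by (auto simp: Dx_def Dy_def Dz_def triples_def
      intro: finite_subset[of _ "Y \<times> Z"] finite_subset[of _ "X \<times> Z"] finite_subset[of _ "X \<times> Y"])
  have "1 \<le> card (Dz - {(x, y)})" using dz card_Diff_ge[of "{(x, y)}" Dz] by (simp add: Dz_def)
  then obtain x1 y1 where xy1: "(x1, y1) \<in> Dz" "(x1, y1) \<noteq> (x, y)"
    by (metis card.empty DiffE ex_in_conv insertI1 not_one_le_zero surj_pair)
  then have T1: "(x1, y1, z) \<in> ?T" by (simp add: Dz_def)
  note t1 = TD[OF T1]
  have ne1: "x1 \<noteq> x" "y1 \<noteq> y" using xy1(2) Px[of x1 x y z] Py[of y1 y x z] t1 xyz by blast+
  have nxy1: "\<not> p x y1" using Py[of y1 y x z] t1 xyz ne1 by blast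
  have nx1y: "\<not> p x1 y" using Px[of x1 x y z] t1 xyz ne1 by blast
  \<comment> \<open>\<open>x2\<close> will be taken from a triple at \<open>y\<close> with
    \<open>\<not> p x2 y1\<close>; \<open>By\<close> holds the triples that violate this. Two of
    them would give complementary triples \<open>(x, y1, b)\<close> and \<open>(x, y1, d)\<close> on
    the common edge \<open>(x, y1)\<close>.\<close>
  define By where "By = {(x', z') \<in> Dy. x' \<noteq> x \<and> p x' y1}"
  have Dy_facts: "x' \<in> X \<and> z' \<in> Z \<and> p x' y \<and> q y z' \<and> r z' x' \<and> z' \<noteq> z \<and> \<not> r z x' \<and> \<not> r z' x"
    if "(x', z') \<in> Dy" "x' \<noteq> x" for x' z'
    using that TD[of x' y z'] Px[of x' x y z] Px[of x' x y z'] xyz unfolding Dy_def by blast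
  have "card By \<le> 1"
  proof (rule card_le_one_if_unique, clarify)
    fix a b c d assume ab: "(a, b) \<in> By" "(c, d) \<in> By"
    note f1 = Dy_facts[of a b] and f2 = Dy_facts[of c d]
    have "\<not> q y1 b" "\<not> q y1 d"
      using ab f1 f2 Py[of y1 y a b] Py[of y1 y c d] t1 xyz ne1 unfolding By_def by blast+
    then have bd: "b = d" using ab f1 f2 Nz[of b d x y1] nxy1 xyz t1 unfolding By_def by blast
    then show "a = c \<and> b = d" using ab f1 f2 Px[of a c y b] xyz unfolding By_def by blast
  qed
  moreover have "card Dy \<le> card (Dy - ({(x, z)} \<union> By)) + card ({(x, z)} \<union> By)"
    using fD unfolding By_def by (intro card_Diff_ge) (auto intro: finite_subset)
  moreover have "card ({(x, z)} \<union> By) \<le> 1 + card By" using card_Un_le[of "{(x, z)}" By] by simp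
  ultimately have "1 \<le> card (Dy - ({(x, z)} \<union> By))" using dy unfolding Dy_def by linarith
  then obtain x2 z2 where x2: "(x2, z2) \<in> Dy" "(x2, z2) \<noteq> (x, z)" "(x2, z2) \<notin> By"
    by (metis card.empty DiffE ex_in_conv UnI1 UnI2 insertI1 not_one_le_zero surj_pair)
  have "x2 \<noteq> x" using x2 TD[of x2 y z2] Pz[of z2 z x y] xyz unfolding Dy_def by blast
  note f2 = Dy_facts[OF x2(1) this]
  have n2: "\<not> p x2 y1" using x2 \<open>x2 \<noteq> x\<close> unfolding By_def by blast
  \<comment> \<open>The triples at \<open>x\<close> that spoil \<open>\<not> r z' x2\<close> or
    \<open>\<not> q y1 z'\<close>. Two in \<open>B1\<close> would give complementary triples on the
    edge \<open>(x2, z)\<close>, two in \<open>B2\<close> on the edge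
    \<open>(x1, y)\<close>.\<close>
  define B1 where "B1 = {(y', z') \<in> Dx. z' \<noteq> z \<and> r z' x2}"
  define B2 where "B2 = {(y', z') \<in> Dx. z' \<noteq> z \<and> q y1 z'}"
  have Dx_facts: "y' \<in> Y \<and> z' \<in> Z \<and> p x y' \<and> q y' z' \<and> r z' x \<and> y' \<noteq> y \<and> \<not> q y' z \<and> \<not> q y z'"
    if "(y', z') \<in> Dx" "z' \<noteq> z" for y' z'
    using that TD[of x y' z'] Py[of y' y x z] Pz[of z' z x y] xyz unfolding Dx_def by blast
  have "card B1 \<le> 1"
  proof (rule card_le_one_if_unique, clarify)
    fix a b c d assume ab: "(a, b) \<in> B1" "(c, d) \<in> B1"
    note f1 = Dx_facts[of a b] and f3 = Dx_facts[of c d]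
    have "\<not> p x2 a" "\<not> p x2 c"
      using ab f1 f2 f3 Px[of x2 x a b] Px[of x2 x c d] xyz \<open>x2 \<noteq> x\<close> unfolding B1_def by blast+
    then have "a = c" using ab f1 f2 f3 Ny[of a c x2 z] xyz unfolding B1_def by blast
    then show "a = c \<and> b = d" using ab f1 f3 Pz[of b d x a] xyz unfolding B1_def by blast
  qed
  moreover have "card B2 \<le> 1"
  proof (rule card_le_one_if_unique, clarify)
    fix a b c d assume ab: "(a, b) \<in> B2" "(c, d) \<in> B2"
    note f1 = Dx_facts[of a b] and f3 = Dx_facts[of c d]
    have "\<not> r b x1" "\<not> r d x1"
      using ab f1 f3 Pz[of b z x1 y1] Pz[of d z x1 y1] xyz t1 unfolding B2_def by blast+
    then have "b = d" using ab f1 f3 Nz[of b d x1 y] xyz t1 nx1y unfolding B2_def by blast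
    then show "a = c \<and> b = d" using ab f1 f3 Py[of a c x b] xyz unfolding B2_def by blast
  qed
  moreover have "card Dx \<le> card (Dx - ({(y, z)} \<union> B1 \<union> B2)) + card ({(y, z)} \<union> B1 \<union> B2)"
    using fD unfolding B1_def B2_def by (intro card_Diff_ge) (auto intro: finite_subset)
  moreover have "card ({(y, z)} \<union> B1 \<union> B2) \<le> 1 + card B1 + card B2"
    using card_Un_le[of "{(y, z)} \<union> B1" B2] card_Un_le[of "{(y, z)}" B1] by simp
  \<comment> \<open>Here the degree 5 enters: removing \<open>(y, z)\<close>, \<open>B1\<close> and
    \<open>B2\<close> takes away at most 3 triples, and two are needed.\<close>
  ultimately have "2 \<le> card (Dx - ({(y, z)} \<union> B1 \<union> B2))" using dx unfolding Dx_def by linarith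
  from ex_distinct_if_card_ge_two[OF this] obtain a b c d where
    ab: "(a, b) \<in> Dx" "(a, b) \<noteq> (y, z)" "(a, b) \<notin> B1" "(a, b) \<notin> B2" and
    cd: "(c, d) \<in> Dx" "(c, d) \<noteq> (y, z)" "(c, d) \<notin> B1" "(c, d) \<notin> B2" and ne: "(a, b) \<noteq> (c, d)"
    by auto
  have "b \<noteq> z" using ab TD[of x a b] Py[of a y x z] xyz unfolding Dx_def by blast
  moreover have "d \<noteq> z" using cd TD[of x c d] Py[of c y x z] xyz unfolding Dx_def by blast
  ultimately have f: "\<not> r b x2" "\<not> q y1 b" "\<not> r d x2" "\<not> q y1 d" "b \<in> Z" "d \<in> Z"
    using ab cd Dx_facts[of a b] Dx_facts[of c d] unfolding B1_def B2_def by blast+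
  then have "b = d" using Nz[of b d x2 y1] f2 n2 t1 by blast
  then show False using ne ab cd TD[of x a b] TD[of x c d] Py[of a c x b] xyz unfolding Dx_def by blast
qed

lemma edge_disjoint_triples_mono:
  assumes "edge_disjoint_triples X Y Z p q r" "X' \<subseteq> X" "Y' \<subseteq> Y" "Z' \<subseteq> Z"
  shows "edge_disjoint_triples X' Y' Z' p q r"
  using assms unfolding edge_disjoint_triples_def by (intro ballI impI conjI; blast)

text \<open>By \<open>low_degree_vertex\<close> every triple has a vertex that lies in at most 4
  triples. Deleting it preserves both hypotheses, so the induction charges 4 triples to each
  vertex.\<close>

lemma card_triples_le:
  fixes X :: "'a set" and Y :: "'b set" and Z :: "'c set"
  assumes "finite X" "finite Y" "finite Z"
    and "edge_disjoint_triples X Y Z p q r"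
    and "edge_disjoint_triples X Y Z (\<lambda>x y. \<not> p x y) (\<lambda>y z. \<not> q y z) (\<lambda>z x. \<not> r z x)"
  shows "card (triples X Y Z p q r) \<le> 4 * (card X + card Y + card Z)"
  using assms
proof (induction "card X + card Y + card Z" arbitrary: X Y Z rule: less_induct)
  case less
  note fin = less.prems(1-3)
  let ?T = "\<lambda>X Y Z. triples X Y Z p q r"
  have IH: "card (?T X' Y' Z') \<le> 4 * (card X' + card Y' + card Z')"
    if "X' \<subseteq> X" "Y' \<subseteq> Y" "Z' \<subseteq> Z" "card X' + card Y' + card Z' < card X + card Y + card Z" for X' Y' Z'
    using less.hyps[of X' Y' Z'] that fin edge_disjoint_triples_mono[OF less.prems(4) that(1-3)]
      edge_disjoint_triples_mono[OF less.prems(5) that(1-3)] by (meson finite_subset)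
  have finT: "finite (?T X Y Z)"
    using fin by (auto simp: triples_def intro: finite_subset[of _ "X \<times> Y \<times> Z"])
  show ?case
  proof (cases "?T X Y Z = {}")
    case False
    then obtain x y z where xyz: "(x, y, z) \<in> ?T X Y Z" by auto
    then have mem: "x \<in> X" "y \<in> Y" "z \<in> Z" by (auto simp: triples_def)
    then have pos: "card X > 0" "card Y > 0" "card Z > 0" using fin card_gt_0_iff by blast+
    have *: "card (?T X Y Z) \<le> card T' + 4"
      if "?T X Y Z \<subseteq> T' \<union> g ` D" "card D \<le> 4" "finite D" "finite T'" for T' and D :: "'d set" and g
    proof -
      have "card (?T X Y Z) \<le> card (T' \<union> g ` D)" using that by (intro card_mono) auto
      also have "\<dots> \<le> card T' + card (g ` D)" by (rule card_Un_le)
      also have "\<dots> \<le> card T' + 4" using card_image_le[OF that(3), of g] that(2) by linarith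
      finally show ?thesis .
    qed
    consider "card {(y', z'). (x, y', z') \<in> ?T X Y Z} \<le> 4"
      | "card {(x', z'). (x', y, z') \<in> ?T X Y Z} \<le> 4"
      | "card {(x', y'). (x', y', z) \<in> ?T X Y Z} \<le> 4"
      using low_degree_vertex[OF less.prems xyz] by fastforce
    then show ?thesis
    proof cases
      case 1
      have "card (?T X Y Z) \<le> card (?T (X - {x}) Y Z) + 4"
        by (rule *[OF _ 1, of _ "\<lambda>(b, d). (x, b, d)"])
          (use fin in \<open>auto simp: triples_def intro: finite_subset[of _ "Y \<times> Z"] finite_subset[of _ "X \<times> Y \<times> Z"]\<close>)
      with IH[of "X - {x}" Y Z] mem pos show ?thesis by (simp add: fin)
    next
      case 2
      have "card (?T X Y Z) \<le> card (?T X (Y - {y}) Z) + 4"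
        by (rule *[OF _ 2, of _ "\<lambda>(a, d). (a, y, d)"])
          (use fin in \<open>auto simp: triples_def intro: finite_subset[of _ "X \<times> Z"] finite_subset[of _ "X \<times> Y \<times> Z"]\<close>)
      with IH[of X "Y - {y}" Z] mem pos show ?thesis by (simp add: fin)
    next
      case 3
      have "card (?T X Y Z) \<le> card (?T X Y (Z - {z})) + 4"
        by (rule *[OF _ 3, of _ "\<lambda>(a, b). (a, b, z)"])
          (use fin in \<open>auto simp: triples_def intro: finite_subset[of _ "X \<times> Y"] finite_subset[of _ "X \<times> Y \<times> Z"]\<close>)
      with IH[of X Y "Z - {z}"] mem pos show ?thesis by (simp add: fin)
    qed
  qed simp
qed

section \<open>Two numerical estimates\<close>

text \<open>The mean of \<open>n\<close> is at least \<open>3 * p / 8\<close>. Light elements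
  contribute at most \<open>p / 4\<close> each and heavy ones at most \<open>p\<close>, so the heavy
  share is at least (3/8 - 1/4) / (1 - 1/4) = 1/6.\<close>

lemma card_heavy_ge:
  fixes n :: "'b \<Rightarrow> nat"
  assumes "finite Z" "0 < p" "\<And>z. z \<in> Z \<Longrightarrow> n z \<le> p" "3 * (p * card Z) \<le> 8 * sum n Z"
  shows "card Z \<le> 6 * card {z \<in> Z. p \<le> 4 * n z}"
proof -
  define A where "A = {z \<in> Z. p \<le> 4 * n z}"
  have A: "A \<subseteq> Z" "finite A" using assms(1) by (auto simp: A_def)
  have "sum n Z = sum n (Z - A) + sum n A" using A assms(1) by (intro sum.subset_diff)
  moreover have "sum n A \<le> card A * p" using A assms(3) by (intro sum_bounded_above[of A n p, simplified]) auto
  moreover have "4 * sum n (Z - A) \<le> card (Z - A) * p"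
    unfolding sum_distrib_left by (rule sum_bounded_above[of "Z - A" "\<lambda>z. 4 * n z" p, simplified]) (auto simp: A_def)
  ultimately have "4 * sum n Z \<le> card (Z - A) * p + 4 * (card A * p)" by linarith
  then have "3 * (p * card Z) \<le> 2 * (card (Z - A) * p) + 8 * (card A * p)" using assms(4) by linarith
  then have "p * (3 * card Z) \<le> p * (2 * card (Z - A) + 8 * card A)" by (simp add: algebra_simps)
  then have "3 * card Z \<le> 2 * card (Z - A) + 8 * card A" using assms(2) by simp
  moreover have "card (Z - A) = card Z - card A" using A by (intro card_Diff_subset) auto
  moreover have "card A \<le> card Z" using A assms(1) by (intro card_mono) auto
  ultimately show ?thesis unfolding A_def by linarith
qed

text \<open>The larger part is bounded by \<open>(m - a) * m powr 0.4\<close>. The smaller one has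
  \<open>a \<le> m / 2\<close>, which saves a factor \<open>2 powr 0.4 \<ge> 1.25\<close> and so a
  fifth of \<open>a * m powr 0.4\<close>.\<close>

lemma powr_split_gain:
  fixes a m :: real
  assumes "0 \<le> a" "a \<le> m / 2"
  shows "a powr 1.4 + (m - a) powr 1.4 + 0.2 * a * m powr 0.4 \<le> m powr 1.4"
proof -
  have e: "x powr 1.4 = x * x powr 0.4" if "0 \<le> x" for x :: real
    using powr_mult_base[OF that, of "0.4"] by simp
  \<comment> \<open>Comparison of fifth powers: 1.25 to the fifth is about 3.05, below
    \<open>2 powr 2\<close>.\<close>
  have 2: "1.25 \<le> (2::real) powr 0.4"
  proof (rule power_le_imp_le_base[of _ 4])
    have "((2::real) powr 0.4) ^ Suc 4 = 2 powr 2" by (simp add: powr_power)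
    then show "(1.25::real) ^ Suc 4 \<le> (2 powr 0.4) ^ Suc 4" by (simp add: power_divide)
  qed simp
  have "a powr 0.4 \<le> (m / 2) powr 0.4" using assms by (intro powr_mono2) auto
  also have "\<dots> = m powr 0.4 / 2 powr 0.4" by (rule powr_divide)
  also have "\<dots> \<le> m powr 0.4 / 1.25" using 2 by (intro divide_left_mono) auto
  finally have "a * a powr 0.4 \<le> a * (m powr 0.4 / 1.25)" using assms by (intro mult_left_mono) auto
  moreover have "(m - a) * (m - a) powr 0.4 \<le> (m - a) * m powr 0.4"
    using assms by (intro mult_left_mono powr_mono2) auto
  ultimately show ?thesis using assms e[of a] e[of "m - a"] e[of m] by (simp add: algebra_simps)
qed

subsection \<open>Symmetric colourings with three colours\<close>

text \<open>For symmetric \<open>col\<close> this already forces the three vertices to be distinct.\<close>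

definition rainbow :: "('a \<Rightarrow> 'a \<Rightarrow> nat) \<Rightarrow> 'a \<Rightarrow> 'a \<Rightarrow> 'a \<Rightarrow> bool" where
  "rainbow col x y z \<longleftrightarrow> col x y \<noteq> col x z \<and> col x y \<noteq> col y z \<and> col x z \<noteq> col y z"

text \<open>\<open>third_unique\<close> is the almost 3-Gallai condition, edge by edge: an edge lies
  in at most one rainbow triangle. It is imposed on the whole type, so it passes to every vertex set
  \<open>S\<close> for free.\<close>

locale gallai3 =
  fixes col :: "'a \<Rightarrow> 'a \<Rightarrow> nat"
  assumes sym: "col x y = col y x"
    and lt3: "col x y < 3"
    and third_unique: "rainbow col x y z \<Longrightarrow> rainbow col x y w \<Longrightarrow> z = w"
begin

definition triangles :: "'a set \<Rightarrow> 'a set set" where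
  "triangles S = {T. \<exists>x\<in>S. \<exists>y\<in>S. \<exists>z\<in>S. T = {x, y, z} \<and> rainbow col x y z}"

lemma rainbow_swap12: "rainbow col x y z \<Longrightarrow> rainbow col y x z"
  unfolding rainbow_def using sym by metis

lemma rainbow_swap23: "rainbow col x y z \<Longrightarrow> rainbow col x z y"
  unfolding rainbow_def using sym by metis

lemma rainbow_distinct:
  assumes "rainbow col x y z" shows "x \<noteq> y" "x \<noteq> z" "y \<noteq> z"
  using assms unfolding rainbow_def by (auto simp: sym)

lemma triangles_mono: "S \<subseteq> S' \<Longrightarrow> triangles S \<subseteq> triangles S'"
  unfolding triangles_def by blast

lemma triangles_subset: "T \<in> triangles S \<Longrightarrow> T \<subseteq> S"
  unfolding triangles_def by auto

lemma triangles_Int: "T \<in> triangles S \<Longrightarrow> T \<subseteq> S' \<Longrightarrow> T \<in> triangles S'"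
  unfolding triangles_def by auto

lemma finite_triangles [intro]: "finite S \<Longrightarrow> finite (triangles S)"
  using triangles_subset by (meson PowI finite_Pow_iff finite_subset subsetI)

lemma card_triangle: "T \<in> triangles S \<Longrightarrow> card T = 3"
  unfolding triangles_def using rainbow_distinct by auto

lemma triangles_vertex:
  assumes "T \<in> triangles S" "a \<in> T"
  shows "\<exists>b\<in>S. \<exists>d\<in>S. T = {a, b, d} \<and> rainbow col a b d"
proof -
  obtain x y z where "x \<in> S" "y \<in> S" "z \<in> S" and T: "T = {x, y, z}" and r: "rainbow col x y z"
    using assms(1) unfolding triangles_def by auto
  moreover have "rainbow col y x z" "rainbow col z x y" using r rainbow_swap12 rainbow_swap23 by blast+
  moreover have "{x, y, z} = {y, x, z}" "{x, y, z} = {z, x, y}" by auto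
  ultimately show ?thesis using assms(2) by (metis empty_iff insert_iff)
qed

lemma triangles_edge:
  assumes "T \<in> triangles S" "a \<in> T" "b \<in> T" "a \<noteq> b"
  shows "\<exists>d\<in>S. T = {a, b, d} \<and> rainbow col a b d"
proof -
  obtain x y where xy: "x \<in> S" "y \<in> S" "T = {a, x, y}" "rainbow col a x y" using triangles_vertex[OF assms(1,2)] by auto
  then have "b = x \<or> b = y" using assms(3,4) by auto
  then show ?thesis using xy rainbow_swap23[of a x y] by (metis insert_commute)
qed

lemma triangles_unique:
  assumes "T \<in> triangles S" "T' \<in> triangles S'" "a \<in> T" "b \<in> T" "a \<in> T'" "b \<in> T'" "a \<noteq> b"
  shows "T = T'"
proof -
  obtain d where "T = {a, b, d}" "rainbow col a b d" using triangles_edge[OF assms(1,3,4,7)] by auto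
  moreover obtain d' where "T' = {a, b, d'}" "rainbow col a b d'" using triangles_edge[OF assms(2,5,6,7)] by auto
  ultimately show ?thesis using third_unique by blast
qed

text \<open>Two triangles at \<open>v\<close> with another common vertex coincide, so choosing a
  member of \<open>Y\<close> in each triangle is injective.\<close>

lemma card_star_le:
  assumes "finite Y" and F: "\<And>T. T \<in> F \<Longrightarrow> T \<in> triangles S \<and> v \<in> T \<and> (\<exists>y\<in>Y. y \<in> T \<and> y \<noteq> v)"
  shows "card F \<le> card Y"
proof -
  from F have "\<forall>T\<in>F. \<exists>y. y \<in> Y \<and> y \<in> T \<and> y \<noteq> v" by blast
  from bchoice[OF this] obtain g where g: "\<forall>T\<in>F. g T \<in> Y \<and> g T \<in> T \<and> g T \<noteq> v" by blast
  have "inj_on g F"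
  proof (rule inj_onI)
    fix T T' assume *: "T \<in> F" "T' \<in> F" "g T = g T'"
    then show "T = T'" using g F[of T] F[of T'] triangles_unique[of T S T' S v "g T"] by metis
  qed
  moreover have "g ` F \<subseteq> Y" using g by blast
  ultimately show ?thesis using assms(1) by (rule card_inj_on_le)
qed

lemma card_triangles_at_le:
  assumes "finite S" shows "card {T \<in> triangles S. v \<in> T} \<le> card S"
proof (rule card_star_le[OF assms])
  fix T assume T: "T \<in> {T \<in> triangles S. v \<in> T}"
  then obtain b d where "b \<in> S" "T = {v, b, d}" "rainbow col v b d" using triangles_vertex[of T S v] by auto
  then show "T \<in> triangles S \<and> v \<in> T \<and> (\<exists>y\<in>S. y \<in> T \<and> y \<noteq> v)" using T rainbow_distinct[of v b d] by auto
qed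

section \<open>Rainbow triangles that meet several classes\<close>

text \<open>Such a triangle is determined by its pair inside class \<open>i\<close>. Its edges to
  the third vertex have the colours \<open>i\<close> and \<open>j\<close>, so the pair carries the
  remaining colour. Each third vertex \<open>z\<close> cuts class \<open>i\<close> by the colour
  seen from \<open>z\<close>; every pair of \<open>H\<close> across this cut is rainbow with
  \<open>z\<close>, and two such pairs with a common vertex \<open>u\<close> would be two triangles
  on the edge \<open>u z\<close>. Hence the cuts are matchings.\<close>

lemma two_in_class_bound:
  fixes k :: "'a \<Rightarrow> nat"
  assumes S: "finite S"
    and k: "\<And>x y. x \<in> S \<Longrightarrow> y \<in> S \<Longrightarrow> k x \<noteq> k y \<Longrightarrow> col x y = k x \<or> col x y = k y"
    and ij: "i \<noteq> j"
  shows "real (card {T \<in> triangles S. \<exists>x y z. T = {x, y, z} \<and> rainbow col x y z \<and> k x = i \<and> k y = i \<and> k z = j})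
    \<le> card S * log 2 (card S)" (is "real (card ?P) \<le> _")
proof -
  define H where "H = {{x, y} |x y. x \<in> S \<and> y \<in> S \<and> k x = i \<and> k y = i \<and> (\<exists>z\<in>S. k z = j \<and> rainbow col x y z)}"
  have PS: "x \<in> S \<and> y \<in> S \<and> z \<in> S" if "{x, y, z} \<in> triangles S" for x y z
    using triangles_subset[OF that] by auto
  define g where "g = (\<lambda>T. {x \<in> T. k x = i})"
  have gP: "\<exists>x y. g T = {x, y} \<and> x \<noteq> y \<and> x \<in> T \<and> y \<in> T \<and> {x, y} \<in> H" if T: "T \<in> ?P" for T
  proof -
    obtain x y z where *: "T = {x, y, z}" "rainbow col x y z" "k x = i" "k y = i" "k z = j" using T by blast
    then have "g T = {x, y}" using ij unfolding g_def by auto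
    moreover have "{x, y} \<in> H" unfolding H_def using * PS[of x y z] T by blast
    ultimately show ?thesis using *(1) rainbow_distinct(1)[OF *(2)] by (metis insertI1 insertI2)
  qed
  have "inj_on g ?P"
  proof (rule inj_onI)
    fix T T' assume *: "T \<in> ?P" "T' \<in> ?P" "g T = g T'"
    obtain x y where xy: "g T = {x, y}" "x \<noteq> y" "x \<in> T" "y \<in> T" using gP[OF *(1)] by blast
    then have "x \<in> T'" "y \<in> T'" using *(3) unfolding g_def by auto
    then show "T = T'" using xy * by (intro triangles_unique[of T S T' S x y]) auto
  qed
  moreover have finH: "finite H" using S by (rule finite_subset[of _ "Pow S", rotated, OF finite_Pow_iff[THEN iffD2]]) (auto simp: H_def)
  moreover have "g ` ?P \<subseteq> H" using gP by fastforce
  ultimately have "card ?P \<le> card H" by (intro card_inj_on_le)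
  moreover have "real (card H) \<le> card S * log 2 (card S)"
  proof (rule matching_cuts_bound[OF S])
    show "e \<subseteq> S" if "e \<in> H" for e using that unfolding H_def by auto
    show "\<exists>x y. e = {x, y}" if "e \<in> H" for e using that unfolding H_def by auto
    fix e assume "e \<in> H"
    then obtain x y z where e: "e = {x, y}" "x \<in> S" "y \<in> S" "k x = i" "k y = i" "z \<in> S" "k z = j" "rainbow col x y z"
      unfolding H_def by blast
    define U where "U = {u. col u z = i}"
    have zc: "u \<in> U \<and> col u z = i \<or> u \<notin> U \<and> col u z = j" if "u \<in> S" "k u = i" for u
      using k[of u z] that e ij unfolding U_def by auto
    have "crosses U e"
      using zc[of x] zc[of y] e unfolding crosses_def rainbow_def by (metis insert_commute)
    moreover have cr: "rainbow col u w z" if "u \<in> U" "w \<notin> U" "{u, w} \<in> H" for u w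
    proof -
      from that(3) obtain x' y' z' where *: "{u, w} = {x', y'}" "x' \<in> S" "y' \<in> S" "k x' = i" "k y' = i"
        "z' \<in> S" "k z' = j" "rainbow col x' y' z'" unfolding H_def by blast
      have "col x' y' \<noteq> i \<and> col x' y' \<noteq> j"
        using k[of x' z'] k[of y' z'] * ij unfolding rainbow_def by auto
      moreover have uw: "col u w = col x' y'" "u \<in> S" "w \<in> S" "k u = i" "k w = i"
        using * sym by (auto simp: doubleton_eq_iff)
      moreover have "col u z = i" "col w z = j" using zc[of u] zc[of w] that uw by auto
      ultimately show ?thesis using ij unfolding rainbow_def by auto
    qed
    have "pairwise disjnt {f \<in> H. crosses U f}"
    proof (rule pairwiseI, rule ccontr)
      fix f f' assume f: "f \<in> {f \<in> H. crosses U f}" "f' \<in> {f \<in> H. crosses U f}" "f \<noteq> f'" "\<not> disjnt f f'"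
      then obtain u w u' w' where uw: "f = {u, w}" "u \<in> U" "w \<notin> U" "f' = {u', w'}" "u' \<in> U" "w' \<notin> U"
        unfolding crosses_def by blast
      have r: "rainbow col u w z" "rainbow col u' w' z" using cr uw f by auto
      from uw f(4) have "u = u' \<or> w = w'" unfolding disjnt_def by auto
      then show False
      proof
        assume "u = u'"
        then have "w = w'" using r third_unique[of u z w w'] rainbow_swap23 by blast
        then show False using \<open>u = u'\<close> uw f(3) by simp
      next
        assume "w = w'"
        then have "u = u'" using r third_unique[of w z u u'] rainbow_swap23 rainbow_swap12 by blast
        then show False using \<open>w = w'\<close> uw f(3) by simp
      qed
    qed
    ultimately show "\<exists>U. crosses U e \<and> pairwise disjnt {f \<in> H. crosses U f}" by blast
  qed
  ultimately show ?thesis by linarith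
qed

text \<open>Each edge between two classes has only two possible colours, so a rainbow triangle
  across all three classes has one of two cyclic patterns. If \<open>p\<close>, \<open>q\<close>,
  \<open>r\<close> describe one pattern, their negations describe the other. Both families are
  edge-disjoint, so \<open>card_triples_le\<close> applies; 12 is 4 for each of the three
  parts.\<close>

lemma three_classes_bound:
  fixes k :: "'a \<Rightarrow> nat"
  assumes S: "finite S"
    and k: "\<And>x y. x \<in> S \<Longrightarrow> y \<in> S \<Longrightarrow> k x \<noteq> k y \<Longrightarrow> col x y = k x \<or> col x y = k y"
    and abc: "a \<noteq> b" "a \<noteq> c" "b \<noteq> c"
  shows "card {T. \<exists>x\<in>S. \<exists>y\<in>S. \<exists>z\<in>S. T = {x, y, z} \<and> k x = a \<and> k y = b \<and> k z = c \<and>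
    col x y = a \<and> col y z = b \<and> col z x = c} \<le> 12 * card S" (is "card ?P \<le> _")
proof -
  define X Y Z where "X = {x \<in> S. k x = a}" and "Y = {x \<in> S. k x = b}" and "Z = {x \<in> S. k x = c}"
  let ?p = "\<lambda>x y. col x y = a" and ?q = "\<lambda>y z. col y z = b" and ?r = "\<lambda>z x. col z x = c"
  have fin: "finite X" "finite Y" "finite Z" using S by (auto simp: X_def Y_def Z_def)
  have np: "\<not> ?p x y \<longleftrightarrow> col x y = b" if "x \<in> X" "y \<in> Y" for x y
    using k[of x y] that abc unfolding X_def Y_def by auto
  have nq: "\<not> ?q y z \<longleftrightarrow> col y z = c" if "y \<in> Y" "z \<in> Z" for y z
    using k[of y z] that abc unfolding Z_def Y_def by auto
  have nr: "\<not> ?r z x \<longleftrightarrow> col z x = a" if "z \<in> Z" "x \<in> X" for z x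
    using k[of z x] that abc unfolding Z_def X_def by auto
  have uniq: "rainbow col x y z \<Longrightarrow> rainbow col x' y z \<Longrightarrow> x' = x"
    "rainbow col x y z \<Longrightarrow> rainbow col x y' z \<Longrightarrow> y' = y" "rainbow col x y z \<Longrightarrow> rainbow col x y z' \<Longrightarrow> z' = z" for x y z x' y' z'
    using third_unique[of y z x' x] third_unique[of x z y' y] third_unique[of x y z' z] rainbow_swap12 rainbow_swap23 by blast+
  have eP: "edge_disjoint_triples X Y Z ?p ?q ?r"
    unfolding edge_disjoint_triples_def
  proof (intro ballI impI conjI)
    fix x y z assume m: "col x y = a \<and> col y z = b \<and> col z x = c"
    then have r: "rainbow col x y z" using abc sym[of x z] unfolding rainbow_def by auto
    have rr: "rainbow col x y z" if "col x y = a \<and> col y z = b \<and> col z x = c" for x y z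
      using that abc sym[of x z] unfolding rainbow_def by auto
    show "x' = x" if "col x' y = a \<and> col z x' = c" for x'
      using uniq(1)[of x y z x'] r rr[of x' y z] that m by blast
    show "y' = y" if "col x y' = a \<and> col y' z = b" for y'
      using uniq(2)[of x y z y'] r rr[of x y' z] that m by blast
    show "z' = z" if "col y z' = b \<and> col z' x = c" for z'
      using uniq(3)[of x y z z'] r rr[of x y z'] that m by blast
  qed
  have eN: "edge_disjoint_triples X Y Z (\<lambda>x y. \<not> ?p x y) (\<lambda>y z. \<not> ?q y z) (\<lambda>z x. \<not> ?r z x)"
    unfolding edge_disjoint_triples_def
  proof (intro ballI impI conjI)
    fix x y z assume m: "x \<in> X" "y \<in> Y" "z \<in> Z" "col x y \<noteq> a \<and> col y z \<noteq> b \<and> col z x \<noteq> c"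
    have rr: "rainbow col x y z"
      if "x \<in> X" "y \<in> Y" "z \<in> Z" "col x y \<noteq> a \<and> col y z \<noteq> b \<and> col z x \<noteq> c" for x y z
      using that np[of x y] nq[of y z] nr[of z x] abc sym[of x z] unfolding rainbow_def by auto
    note r = rr[OF m]
    show "x' = x" if "x' \<in> X" "col x' y \<noteq> a \<and> col z x' \<noteq> c" for x'
      using uniq(1)[of x y z x'] r rr[of x' y z] that m by blast
    show "y' = y" if "y' \<in> Y" "col x y' \<noteq> a \<and> col y' z \<noteq> b" for y'
      using uniq(2)[of x y z y'] r rr[of x y' z] that m by blast
    show "z' = z" if "z' \<in> Z" "col y z' \<noteq> b \<and> col z' x \<noteq> c" for z'
      using uniq(3)[of x y z z'] r rr[of x y z'] that m by blast
  qed
  let ?T = "triples X Y Z ?p ?q ?r"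
  have "?P \<subseteq> (\<lambda>(x, y, z). {x, y, z}) ` ?T"
    unfolding triples_def X_def Y_def Z_def by (auto simp: image_iff)
  moreover have finT: "finite ?T"
    using fin by (auto simp: triples_def intro: finite_subset[of _ "X \<times> Y \<times> Z"])
  ultimately have "card ?P \<le> card ?T" by (meson card_image_le card_mono finite_imageI le_trans)
  also have "\<dots> \<le> 4 * (card X + card Y + card Z)" by (rule card_triples_le[OF fin eP eN])
  also have "\<dots> \<le> 12 * card S"
    using card_mono[of S X] card_mono[of S Y] card_mono[of S Z] S by (auto simp: X_def Y_def Z_def)
  finally show ?thesis .
qed

text \<open>Bounds the triangles not inside one class: at most 9 pairs of classes from
  \<open>two_in_class_bound\<close>, and two cyclic patterns at \<open>12 * s\<close> from
  \<open>three_classes_bound\<close>.\<close>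

definition cross_bound :: "nat \<Rightarrow> real" where
  "cross_bound s = 9 * (s * log 2 s) + 24 * s"

lemma cross_bound_mono: "s \<le> t \<Longrightarrow> cross_bound s \<le> cross_bound t"
proof -
  assume *: "s \<le> t"
  have "s * log 2 s \<le> t * log 2 t"
  proof (cases "s = 0")
    case True then show ?thesis by (cases "t = 0") auto
  next
    case False with * show ?thesis by (intro mult_mono) auto
  qed
  then show ?thesis using * unfolding cross_bound_def by simp
qed

text \<open>A triangle that leaves its class either has exactly two vertices in one class, counted
  by \<open>Q\<close>, or meets all three classes, counted by \<open>P\<close> in its two
  orientations.\<close>

lemma between_classes_bound:
  fixes k :: "'a \<Rightarrow> nat"
  assumes S: "finite S" and k3: "\<And>x. x \<in> S \<Longrightarrow> k x < 3"
    and k: "\<And>x y. x \<in> S \<Longrightarrow> y \<in> S \<Longrightarrow> k x \<noteq> k y \<Longrightarrow> col x y = k x \<or> col x y = k y"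
  shows "real (card {T \<in> triangles S. \<not> (\<exists>i. \<forall>x\<in>T. k x = i)}) \<le> cross_bound (card S)" (is "real (card ?M) \<le> _")
proof -
  define Q where "Q = (\<lambda>i j. {T \<in> triangles S. \<exists>x y z. T = {x, y, z} \<and> rainbow col x y z \<and> k x = i \<and> k y = i \<and> k z = j})"
  define P where "P = (\<lambda>a b c. {T. \<exists>x\<in>S. \<exists>y\<in>S. \<exists>z\<in>S. T = {x, y, z} \<and> k x = a \<and> k y = b \<and> k z = c \<and>
    col x y = a \<and> col y z = b \<and> col z x = c})"
  define IJ where "IJ = {(i, j). i < 3 \<and> j < (3::nat) \<and> i \<noteq> j}"
  have IJs: "IJ \<subseteq> {..<3} \<times> {..<3}" unfolding IJ_def by auto
  then have finIJ: "finite IJ" by (rule finite_subset) auto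
  have cIJ: "card IJ \<le> 9" using card_mono[OF _ IJs] by simp
  have sub: "?M \<subseteq> (\<Union>(i, j)\<in>IJ. Q i j) \<union> (P 0 1 2 \<union> P 2 1 0)"
  proof
    fix T assume T: "T \<in> ?M"
    show "T \<in> (\<Union>(i, j)\<in>IJ. Q i j) \<union> (P 0 1 2 \<union> P 2 1 0)"
    proof (cases "\<exists>x\<in>T. \<exists>y\<in>T. x \<noteq> y \<and> k x = k y")
      case True
      then obtain x y where xy: "x \<in> T" "y \<in> T" "x \<noteq> y" "k x = k y" by auto
      then obtain z where z: "z \<in> S" "T = {x, y, z}" "rainbow col x y z" using triangles_edge[of T S x y] T by auto
      then have "k z \<noteq> k x" using T xy by auto
      moreover have "x \<in> S" using T xy triangles_subset by auto
      ultimately have "(k x, k z) \<in> IJ" "T \<in> Q (k x) (k z)"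
        using z xy T k3[of x] k3[of z] unfolding IJ_def Q_def by auto
      then show ?thesis by auto
    next
      case False
      have "card (k ` T) = 3"
        using False card_triangle[of T S] T by (subst card_image) (auto simp: inj_on_def)
      moreover have "k ` T \<subseteq> {..<3}" using T triangles_subset k3 by auto
      ultimately have "k ` T = {..<3}" by (intro card_subset_eq) auto
      then have "0 \<in> k ` T" "1 \<in> k ` T" "2 \<in> k ` T" by auto
      then obtain x y z where xyz: "x \<in> T" "y \<in> T" "z \<in> T" "k x = 0" "k y = 1" "k z = 2"
        by (metis imageE)
      then have "x \<noteq> y" "z \<noteq> x" "z \<noteq> y" by auto
      then obtain d where d: "T = {x, y, d}" "rainbow col x y d" using triangles_edge[of T S x y] xyz T by auto
      then have "d = z" using xyz \<open>z \<noteq> x\<close> \<open>z \<noteq> y\<close> by auto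
      have S: "x \<in> S" "y \<in> S" "z \<in> S" using xyz T triangles_subset by auto
      have c: "col x y = 0 \<or> col x y = 1" "col y z = 1 \<or> col y z = 2" "col z x = 0 \<or> col z x = 2"
        using k[of x y] k[of y z] k[of z x] S xyz by auto
      have r: "col x y \<noteq> col z x" "col x y \<noteq> col y z" "col z x \<noteq> col y z"
        using d(2) \<open>d = z\<close> sym[of x z] unfolding rainbow_def by auto
      \<comment> \<open>The colours of \<open>x y\<close>, \<open>y z\<close>, \<open>z x\<close>
        are either 0, 1, 2 or 1, 2, 0. The second pattern, read backwards from \<open>z\<close>, is
        the one counted by \<open>P 2 1 0\<close>.\<close>
      from c r consider "col x y = 0" "col y z = 1" "col z x = 2" | "col z y = 2" "col y x = 1" "col x z = 0"
        using sym by (metis zero_neq_one)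
      then show ?thesis
      proof cases
        case 1
        then have "T \<in> P 0 1 2" using S xyz d \<open>d = z\<close> unfolding P_def by blast
        then show ?thesis by simp
      next
        case 2
        moreover have "T = {z, y, x}" using d \<open>d = z\<close> by auto
        ultimately have "T \<in> P 2 1 0" using S xyz unfolding P_def by blast
        then show ?thesis by simp
      qed
    qed
  qed
  have finU: "finite (\<Union>(i, j)\<in>IJ. Q i j)" using finIJ finite_triangles[OF S] unfolding Q_def by auto
  have finP: "finite (P a b c)" for a b c
    using S by (rule finite_subset[of _ "Pow S", rotated, OF finite_Pow_iff[THEN iffD2]]) (auto simp: P_def)
  have "card ?M \<le> card ((\<Union>(i, j)\<in>IJ. Q i j) \<union> (P 0 1 2 \<union> P 2 1 0))"
    by (rule card_mono[OF _ sub]) (use finU finP in auto)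
  also have "\<dots> \<le> card (\<Union>(i, j)\<in>IJ. Q i j) + (card (P 0 1 2) + card (P 2 1 0))"
    by (meson card_Un_le add_le_mono le_refl le_trans)
  also have "\<dots> \<le> card (\<Union>(i, j)\<in>IJ. Q i j) + (12 * card S + 12 * card S)"
    unfolding P_def by (intro add_mono three_classes_bound S k) auto
  finally have 1: "real (card ?M) \<le> card (\<Union>(i, j)\<in>IJ. Q i j) + 24 * card S" by simp
  have "card (\<Union>(i, j)\<in>IJ. Q i j) \<le> (\<Sum>(i, j)\<in>IJ. card (Q i j))"
    using card_UN_le[OF finIJ, of "\<lambda>(i, j). Q i j"] by (simp add: case_prod_beta)
  then have "real (card (\<Union>(i, j)\<in>IJ. Q i j)) \<le> (\<Sum>(i, j)\<in>IJ. real (card (Q i j)))"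
    by (simp add: case_prod_beta flip: of_nat_sum)
  also have "\<dots> \<le> (\<Sum>(i, j)\<in>IJ. card S * log 2 (card S))"
    unfolding Q_def by (intro sum_mono) (auto simp: IJ_def intro!: two_in_class_bound[OF S k])
  also have "\<dots> = card IJ * (card S * log 2 (card S))" by (simp add: case_prod_beta)
  also have "\<dots> \<le> 9 * (card S * log 2 (card S))"
  proof (intro mult_right_mono)
    show "0 \<le> card S * log 2 (card S)" by (cases "card S = 0") auto
  qed (use cIJ in simp)
  finally show ?thesis using 1 unfolding cross_bound_def by linarith
qed

text \<open>
  An edge between two neighbourhoods of \<open>v\<close> that carries the third colour spans a rainbow triangle with
  \<open>v\<close>, so these edges form a matching. Sampling the vertices removes them, at the cost of a
  factor 64, and leaves the situation of the previous lemma.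
\<close>

lemma between_neighbourhoods_bound:
  assumes S: "finite S"
  shows "real (card {T \<in> triangles (S - {v}). \<not> (\<exists>i. \<forall>x\<in>T. col v x = i)}) \<le> 64 * cross_bound (card S)" (is "real (card ?C) \<le> _")
proof -
  \<comment> \<open>\<open>N T\<close> collects the vertices completing a rainbow triangle with
    \<open>v\<close> and a vertex of \<open>T\<close>, at most one for each vertex of
    \<open>T\<close>. Keeping \<open>T\<close> and avoiding \<open>N T\<close> constrains at most 6
    vertices, whence the factor \<open>2 ^ 6\<close>.\<close>
  define N where "N = (\<lambda>T. {y \<in> S - {v}. \<exists>x\<in>T. rainbow col v x y})"
  have fC: "finite ?C" using finite_triangles[of "S - {v}"] S by simp
  have cN: "T \<subseteq> S - {v} \<and> N T \<subseteq> S - {v} \<and> T \<inter> N T = {} \<and> card T + card (N T) \<le> 6" if T: "T \<in> ?C" for T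
  proof (intro conjI)
    show "T \<subseteq> S - {v}" using T triangles_subset by blast
    show "N T \<subseteq> S - {v}" unfolding N_def by auto
    show "T \<inter> N T = {}"
    proof (rule ccontr)
      assume "T \<inter> N T \<noteq> {}"
      then obtain x y where xy: "x \<in> T" "y \<in> T" "rainbow col v x y" unfolding N_def by auto
      then obtain d where "T = {x, y, d}" "rainbow col x y d"
        using triangles_edge[of T "S - {v}" x y] T rainbow_distinct[of v x y] by auto
      moreover have "rainbow col x y v" using xy(3) rainbow_swap12 rainbow_swap23 by blast
      ultimately have "v \<in> T" using third_unique by blast
      then show False using \<open>T \<subseteq> S - {v}\<close> by auto
    qed
    define f where "f = (\<lambda>x. SOME y. rainbow col v x y)"
    have "N T \<subseteq> f ` T"
    proof
      fix y assume "y \<in> N T"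
      then obtain x where x: "x \<in> T" "rainbow col v x y" unfolding N_def by auto
      then have "rainbow col v x (f x)" unfolding f_def by (meson someI)
      then show "y \<in> f ` T" using x third_unique by blast
    qed
    moreover have cT: "card T = 3" "finite T" using T card_triangle[of T] card.infinite by force+
    ultimately have "card (N T) \<le> card T" by (meson card_image_le card_mono finite_imageI le_trans)
    then show "card T + card (N T) \<le> 6" using cT by simp
  qed
  obtain R where R: "R \<subseteq> S - {v}" "card ?C \<le> 2 ^ 6 * card {T \<in> ?C. T \<subseteq> R \<and> N T \<inter> R = {}}"
    using exists_good_sample[of ?C "S - {v}" "\<lambda>T. T" N 6] fC S cN by auto
  define C' where "C' = {T \<in> ?C. T \<subseteq> R \<and> N T \<inter> R = {}}"
  \<comment> \<open>Only vertices of surviving triangles are kept. If \<open>x\<close> lies in a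
    surviving \<open>T\<close>, each vertex of \<open>S - {v}\<close> that is rainbow with
    \<open>v\<close> and \<open>x\<close> belongs to \<open>N T\<close>, hence lies outside
    \<open>R\<close>.\<close>
  define R' where "R' = \<Union>C'"
  have R'R: "R' \<subseteq> R" unfolding R'_def C'_def by auto
  then have fR: "finite R'" "card R' \<le> card S"
    using R(1) S by (auto intro: finite_subset card_mono)
  have "C' \<subseteq> {T \<in> triangles R'. \<not> (\<exists>i. \<forall>x\<in>T. col v x = i)}"
  proof
    fix T assume T: "T \<in> C'"
    then have "T \<subseteq> R'" unfolding R'_def by auto
    then show "T \<in> {T \<in> triangles R'. \<not> (\<exists>i. \<forall>x\<in>T. col v x = i)}"
      using T triangles_Int[of T "S - {v}" R'] unfolding C'_def by simp
  qed
  then have "card C' \<le> card {T \<in> triangles R'. \<not> (\<exists>i. \<forall>x\<in>T. col v x = i)}"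
    using finite_triangles[OF fR(1)] by (intro card_mono) auto
  moreover have "real (card {T \<in> triangles R'. \<not> (\<exists>i. \<forall>x\<in>T. col v x = i)}) \<le> cross_bound (card R')"
  proof (rule between_classes_bound[OF fR(1)])
    fix x y assume xy: "x \<in> R'" "y \<in> R'" "col v x \<noteq> col v y"
    then obtain T where "x \<in> T" "T \<in> C'" unfolding R'_def by auto
    moreover have "y \<in> R" "y \<in> S - {v}" using xy R'R R by auto
    ultimately have "\<not> rainbow col v x y" unfolding C'_def N_def by auto
    then show "col x y = col v x \<or> col x y = col v y" using xy(3) unfolding rainbow_def by auto
  qed (rule lt3)
  ultimately have "real (card C') \<le> cross_bound (card S)" using cross_bound_mono[OF fR(2)] by linarith
  then show ?thesis using R(2) unfolding C'_def by (simp add: field_simps)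
qed

section \<open>Vertex sets in which one colour dominates\<close>

text \<open>
  The set \<open>W\<close> of the proof contains every vertex that some \<open>z \<in> A\<close> sees in a colour other than \<open>a\<close>. It is
  small: a vertex \<open>w\<close> that \<open>v\<close> sees in colour \<open>a\<close> and \<open>z\<close> in colour \<open>c\<close> must see nearly all of the many
  \<open>b\<close>-neighbours of \<open>z\<close> in \<open>Y\<close> in colour \<open>b\<close>, and vertices of \<open>Y\<close> have few neighbours in colour \<open>b\<close>.
\<close>

lemma heavy_part_bound:
  assumes D: "finite D" "v \<in> D"
    and abc: "a \<noteq> b" "a \<noteq> c" "b \<noteq> c" "a < 3" "b < 3" "c < 3"
    and deg: "\<And>u. u \<in> D \<Longrightarrow> real (card {x \<in> D. x \<noteq> u \<and> col u x \<noteq> a}) \<le> \<sigma>"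
    and Y: "Y = {y \<in> D. y \<noteq> v \<and> col v y = b}" and Z: "Z = {z \<in> D. z \<noteq> v \<and> col v z = c}"
    and p: "16 \<le> card Y"
    and A: "A = {z \<in> Z. card Y \<le> 4 * card {y \<in> Y. col y z = b}}"
  shows "\<exists>w. real w \<le> 11 * \<sigma> \<and>
    real (card {T \<in> triangles D. T \<inter> A \<noteq> {}}) \<le> 3 * w + 64 * cross_bound w + card (triangles Z)"
proof -
  have cl: "col x y = a \<or> col x y = b \<or> col x y = c" for x y
    using lt3[of x y] abc by linarith
  define Wb where "Wb = {w \<in> D. w \<noteq> v \<and> col v w = a \<and> (\<exists>z\<in>A. col w z = b)}"
  define Wc where "Wc = {w \<in> D. w \<noteq> v \<and> col v w = a \<and> (\<exists>z\<in>A. col w z = c)}"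
  define W where "W = {v} \<union> (Y \<union> Z) \<union> (Wb \<union> Wc)"
  have AZ: "A \<subseteq> Z" unfolding A by auto
  have sub: "Y \<subseteq> D" "Z \<subseteq> D" "A \<subseteq> D" "Wb \<subseteq> D" "Wc \<subseteq> D" "W \<subseteq> D" "A \<subseteq> W"
    using D AZ unfolding Y Z Wb_def Wc_def W_def by auto
  then have fin: "finite Y" "finite Z" "finite A" "finite Wb" "finite Wc" "finite W"
    using D(1) finite_subset by metis+
  have out: "col x z = a" if "x \<in> D" "x \<notin> W" "z \<in> A" for x z
    using cl[of x z] cl[of v x] that unfolding W_def Wb_def Wc_def Y Z by auto
  have YZ: "real (card (Y \<union> Z)) \<le> \<sigma>"
  proof -
    have "card (Y \<union> Z) \<le> card {x \<in> D. x \<noteq> v \<and> col v x \<noteq> a}"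
      using D abc unfolding Y Z by (intro card_mono) auto
    then show ?thesis using deg[OF D(2)] by linarith
  qed
  have "card A \<le> card (Y \<union> Z)" using AZ fin by (intro card_mono) auto
  then have cA: "real (card A) \<le> \<sigma>" using YZ by linarith
  have "1 \<le> card Y" using p by simp
  then have s1: "1 \<le> \<sigma>" using YZ card_mono[of "Y \<union> Z" Y] fin by auto
  \<comment> \<open>If \<open>col w z = b\<close>, then \<open>v\<close>, \<open>z\<close>,
    \<open>w\<close> are rainbow with colours \<open>c\<close>, \<open>a\<close>, \<open>b\<close>,
    so \<open>z\<close> determines \<open>w\<close>.\<close>
  have "card Wb \<le> card A"
  proof -
    have "\<forall>w\<in>Wb. \<exists>z. z \<in> A \<and> col w z = b" unfolding Wb_def by blast
    from bchoice[OF this] obtain f where f: "\<forall>w\<in>Wb. f w \<in> A \<and> col w (f w) = b" by blast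
    have rbw: "rainbow col v (f w) w" if "w \<in> Wb" for w
    proof -
      have "f w \<in> Z" "col v w = a" "col w (f w) = b" using f that AZ unfolding Wb_def by auto
      then show ?thesis using abc sym[of w "f w"] unfolding rainbow_def Z by auto
    qed
    have "inj_on f Wb" by (rule inj_onI) (metis rbw third_unique)
    then show ?thesis using f fin by (intro card_inj_on_le[of f]) auto
  qed
  then have cWb: "real (card Wb) \<le> \<sigma>" using cA by linarith
  \<comment> \<open>At least a quarter of \<open>Y\<close> is joined to \<open>z\<close> in colour
    \<open>b\<close>. Among these \<open>y\<close>, at most one has \<open>col w y = c\<close>
    (rainbow with \<open>v\<close> and \<open>w\<close>) and at most one has
    \<open>col w y = a\<close> (rainbow with \<open>w\<close> and \<open>z\<close>). A quarter minus
    2 is at least an eighth because \<open>card Y \<ge> 16\<close>.\<close>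
  have many: "card Y \<le> 8 * card {y \<in> Y. col w y = b}" if w: "w \<in> Wc" for w
  proof -
    obtain z where z: "z \<in> A" "col w z = c" using w unfolding Wc_def by auto
    have wa: "col v w = a" using w unfolding Wc_def by auto
    let ?B = "{y \<in> Y. col w y = b}" and ?C = "{y \<in> Y. col w y = c}" and ?E = "{y \<in> Y. col y z = b \<and> col w y = a}"
    have "card ?C \<le> 1"
    proof (rule card_le_one_if_unique)
      fix y y' assume "y \<in> ?C" "y' \<in> ?C"
      then have "rainbow col v w y" "rainbow col v w y'" using wa abc unfolding rainbow_def Y by auto
      then show "y = y'" by (rule third_unique)
    qed
    moreover have "card ?E \<le> 1"
    proof (rule card_le_one_if_unique)
      fix y y' assume "y \<in> ?E" "y' \<in> ?E"
      then have "rainbow col w z y" "rainbow col w z y'" using z abc sym[of z] unfolding rainbow_def by auto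
      then show "y = y'" by (rule third_unique)
    qed
    moreover have "card {y \<in> Y. col y z = b} \<le> card (?B \<union> ?C \<union> ?E)"
      using fin cl[of w] by (intro card_mono) auto
    moreover have "card (?B \<union> ?C \<union> ?E) \<le> card ?B + card ?C + card ?E"
      by (meson card_Un_le add_le_mono le_refl le_trans)
    moreover have "card Y \<le> 4 * card {y \<in> Y. col y z = b}" using z unfolding A by auto
    ultimately show ?thesis using p by linarith
  qed
  \<comment> \<open>Double counting of the \<open>b\<close>-edges between \<open>Wc\<close> and
    \<open>Y\<close>: at least \<open>card Y / 8\<close> at each \<open>w\<close>, at most \<sigma>
    at each \<open>y\<close>.\<close>
  have cWc: "real (card Wc) \<le> 8 * \<sigma>"
  proof -
    have "card Wc * card Y = (\<Sum>w\<in>Wc. card Y)" by simp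
    also have "\<dots> \<le> (\<Sum>w\<in>Wc. 8 * card {y \<in> Y. col w y = b})" by (rule sum_mono) (rule many)
    also have "\<dots> = 8 * (\<Sum>w\<in>Wc. card {y \<in> Y. col w y = b})" by (simp add: sum_distrib_left)
    also have "(\<Sum>w\<in>Wc. card {y \<in> Y. col w y = b}) = (\<Sum>y\<in>Y. card {w \<in> Wc. col w y = b})"
      using fin by (intro sum_multicount_gen) auto
    finally have "real (card Wc * card Y) \<le> 8 * (\<Sum>y\<in>Y. real (card {w \<in> Wc. col w y = b}))"
      by (simp flip: of_nat_sum of_nat_mult)
    also have "\<dots> \<le> 8 * (\<Sum>y\<in>Y. \<sigma>)"
    proof (intro mult_left_mono sum_mono)
      fix y assume y: "y \<in> Y"
      have "{w \<in> Wc. col w y = b} \<subseteq> {x \<in> D. x \<noteq> y \<and> col y x \<noteq> a}"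
        using y abc sym[of y] unfolding Wc_def Y by auto
      then have "card {w \<in> Wc. col w y = b} \<le> card {x \<in> D. x \<noteq> y \<and> col y x \<noteq> a}"
        using D by (intro card_mono) auto
      then show "real (card {w \<in> Wc. col w y = b}) \<le> \<sigma>" using deg[of y] y sub by force
    qed simp
    finally have "real (card Y) * real (card Wc) \<le> real (card Y) * (8 * \<sigma>)" by (simp add: algebra_simps)
    then show ?thesis using p by simp
  qed
  have "card W \<le> card {v} + card (Y \<union> Z) + card (Wb \<union> Wc)"
    unfolding W_def by (meson card_Un_le add_le_mono le_refl le_trans)
  also have "\<dots> \<le> 1 + card (Y \<union> Z) + (card Wb + card Wc)" using card_Un_le[of Wb Wc] by simp
  \<comment> \<open>The summands are 1 for \<open>v\<close> (at most \<sigma>), \<sigma> for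
    \<open>Y \<union> Z\<close>, \<sigma> for \<open>Wb\<close> and \<open>8 * \<sigma>\<close> for
    \<open>Wc\<close>.\<close>
  finally have cW: "real (card W) \<le> 11 * \<sigma>" using YZ cWb cWc s1 by linarith

  let ?M1 = "{T \<in> triangles D. T \<inter> A \<noteq> {} \<and> \<not> T \<subseteq> W}"
  let ?M2 = "{T \<in> triangles W. v \<in> T}"
  let ?M3 = "{T \<in> triangles (W - {v}). \<not> (\<exists>i. \<forall>x\<in>T. col v x = i)}"
  have "card ?M1 \<le> card (W \<times> {b, c})"
  proof -
    \<comment> \<open>A triangle with \<open>z\<close> in \<open>A\<close> and \<open>x\<close>
      outside \<open>W\<close> has \<open>col z x = a\<close>, so its third vertex \<open>d\<close>
      lies in \<open>W\<close>. The pair of \<open>d\<close> and the colour of \<open>z d\<close>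
      determines the triangle: two candidates \<open>z1\<close>, \<open>z2\<close> would both be
      rainbow with the edge \<open>x1 d\<close>.\<close>
    have "\<forall>T\<in>?M1. \<exists>h. h \<in> W \<times> {b, c} \<and> (\<exists>z x. T = {z, x, fst h} \<and> z \<in> A \<and> x \<in> D \<and> x \<notin> W \<and>
        rainbow col z x (fst h) \<and> col z (fst h) = snd h)"
    proof
      fix T assume T: "T \<in> ?M1"
      then obtain z x where zx: "z \<in> T" "z \<in> A" "x \<in> T" "x \<notin> W" by auto
      then have "z \<noteq> x" using sub by auto
      then obtain d where d: "d \<in> D" "T = {z, x, d}" "rainbow col z x d"
        using triangles_edge[of T D z x] T zx by auto
      have xD: "x \<in> D" using T zx triangles_subset by auto
      have "col z x = a" using out[OF xD zx(4,2)] sym by metis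
      then have "col z d \<noteq> a" using d unfolding rainbow_def by auto
      then have "d \<in> W" "col z d \<in> {b, c}" using out[of d z] d zx cl[of z d] sym[of d z] by auto
      then show "\<exists>h. h \<in> W \<times> {b, c} \<and> (\<exists>z x. T = {z, x, fst h} \<and> z \<in> A \<and> x \<in> D \<and> x \<notin> W \<and>
        rainbow col z x (fst h) \<and> col z (fst h) = snd h)"
        using d zx xD by (intro exI[of _ "(d, col z d)"]) auto
    qed
    from bchoice[OF this] obtain h where h: "\<forall>T\<in>?M1. h T \<in> W \<times> {b, c} \<and> (\<exists>z x. T = {z, x, fst (h T)} \<and> z \<in> A \<and> x \<in> D \<and> x \<notin> W \<and>
        rainbow col z x (fst (h T)) \<and> col z (fst (h T)) = snd (h T))" by blast
    have "inj_on h ?M1"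
    proof (rule inj_onI)
      fix T1 T2 assume T: "T1 \<in> ?M1" "T2 \<in> ?M1" "h T1 = h T2"
      obtain d \<beta> where dh: "h T1 = (d, \<beta>)" by fastforce
      obtain z1 x1 where 1: "T1 = {z1, x1, d}" "z1 \<in> A" "x1 \<in> D" "x1 \<notin> W" "rainbow col z1 x1 d" "col z1 d = \<beta>"
        using h T(1) dh by force
      obtain z2 x2 where 2: "T2 = {z2, x2, d}" "z2 \<in> A" "x2 \<in> D" "x2 \<notin> W" "rainbow col z2 x2 d" "col z2 d = \<beta>"
        using h T(2) T(3) dh by force
      have o: "col x1 z1 = a" "col x1 z2 = a" "col x2 z2 = a" using out 1 2 by auto
      have "rainbow col x1 d z1" using 1 rainbow_swap12 rainbow_swap23 by blast
      moreover have "rainbow col x1 d z2"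
        using calculation o 1 2 sym[of d z2] sym[of d z1] unfolding rainbow_def by auto
      ultimately have z: "z1 = z2" by (rule third_unique)
      have "rainbow col z1 d x1" "rainbow col z1 d x2" using 1 2 z rainbow_swap23 by blast+
      then have "x1 = x2" by (rule third_unique)
      then show "T1 = T2" using z 1 2 by simp
    qed
    then show ?thesis using h fin by (intro card_inj_on_le[of h]) auto
  qed
  also have "\<dots> = card W * 2" using abc by (simp add: card_cartesian_product)
  finally have M1: "card ?M1 \<le> 2 * card W" by simp
  have M2: "card ?M2 \<le> card W" by (rule card_triangles_at_le[OF fin(6)])
  have M3: "real (card ?M3) \<le> 64 * cross_bound (card W)" by (rule between_neighbourhoods_bound[OF fin(6)])
  have "{T \<in> triangles D. T \<inter> A \<noteq> {}} \<subseteq> ?M1 \<union> ?M2 \<union> ?M3 \<union> triangles Z"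
  proof
    fix T assume T: "T \<in> {T \<in> triangles D. T \<inter> A \<noteq> {}}"
    show "T \<in> ?M1 \<union> ?M2 \<union> ?M3 \<union> triangles Z"
    \<comment> \<open>In the remaining case \<open>v\<close> sees all of \<open>T\<close> in one
      colour; this colour is \<open>c\<close>, as \<open>T\<close> meets \<open>A\<close>, and
      \<open>T\<close> lies in \<open>Z\<close>.\<close>
    proof (cases "T \<subseteq> W \<and> v \<notin> T \<and> (\<exists>i. \<forall>x\<in>T. col v x = i)")
      case True
      then obtain i where i: "\<forall>x\<in>T. col v x = i" by auto
      moreover obtain z where "z \<in> T" "z \<in> A" using T by auto
      ultimately have "\<forall>x\<in>T. col v x = c" using AZ unfolding Z by auto
      then have "T \<subseteq> Z" using True sub unfolding Z by auto
      then have "T \<in> triangles Z" using T triangles_Int by blast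
      then show ?thesis by simp
    next
      case False
      have "T \<in> triangles W" if "T \<subseteq> W" using T that triangles_Int by blast
      moreover have "T \<in> triangles (W - {v})" if "T \<subseteq> W" "v \<notin> T" using T that triangles_Int[of T D "W - {v}"] by blast
      ultimately show ?thesis using False T by blast
    qed
  qed
  then have "card {T \<in> triangles D. T \<inter> A \<noteq> {}} \<le> card (?M1 \<union> ?M2 \<union> ?M3 \<union> triangles Z)"
    using finite_triangles[OF D(1)] finite_triangles[OF fin(6)] finite_triangles[OF fin(2)] finite_triangles[of "W - {v}"] fin(6)
    by (intro card_mono) simp_all
  also have "\<dots> \<le> card ?M1 + card ?M2 + card ?M3 + card (triangles Z)"
    by (meson card_Un_le add_le_mono le_refl le_trans)
  finally have "real (card {T \<in> triangles D. T \<inter> A \<noteq> {}}) \<le> 3 * card W + 64 * cross_bound (card W) + card (triangles Z)"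
    using M1 M2 M3 by linarith
  then show ?thesis using cW by (intro exI[of _ "card W"]) simp
qed

text \<open>Every rainbow triangle uses all three colours, so it has an apex opposite its edge of
  colour \<open>a\<close>. If each vertex is apex of at most \<open>K\<close> triangles, summation
  suffices. Otherwise some \<open>v\<close> is apex of more, so \<open>Y\<close> and
  \<open>Z\<close> both exceed \<open>K\<close>, and a fixed fraction of one of them is heavy in the
  sense of \<open>heavy_part_bound\<close>. Deleting it destroys at most \<open>K\<close> triangles
  per deleted vertex, and induction applies. \<tau> bounds the triangles inside \<open>Y\<close> or
  \<open>Z\<close>.\<close>

lemma sparse_bound:
  fixes K \<sigma> \<tau> :: real
  assumes D: "finite D"
    and abc: "a \<noteq> b" "a \<noteq> c" "b \<noteq> c" "a < 3" "b < 3" "c < 3"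
    and deg: "\<And>u. u \<in> D \<Longrightarrow> real (card {x \<in> D. x \<noteq> u \<and> col u x \<noteq> a}) \<le> \<sigma>"
    and tau: "\<And>Q. Q \<subseteq> D \<Longrightarrow> real (card Q) \<le> \<sigma> \<Longrightarrow> real (card (triangles Q)) \<le> \<tau> * card Q"
    and K: "16 \<le> K" "12 * \<tau> \<le> K" "0 \<le> \<tau>"
    and LBK: "\<And>w. real w \<le> 11 * \<sigma> \<Longrightarrow> 12 * (3 * w + 64 * cross_bound w) \<le> K * K"
  shows "real (card (triangles D)) \<le> K * card D"
  using D deg tau
proof (induction "card D" arbitrary: D rule: less_induct)
  case less
  note D = less.prems(1) and deg = less.prems(2) and tau = less.prems(3)
  have cl: "col x y = a \<or> col x y = b \<or> col x y = c" for x y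
    using lt3[of x y] abc by linarith
  define apex where "apex = (\<lambda>v. {T \<in> triangles D. \<exists>y z. T = {v, y, z} \<and> rainbow col v y z \<and> col v y = b \<and> col v z = c})"
  show ?case
  proof (cases "\<forall>v\<in>D. real (card (apex v)) \<le> K")
    case True
    have "triangles D \<subseteq> (\<Union>v\<in>D. apex v)"
    proof
      fix T assume T: "T \<in> triangles D"
      then obtain x y z where xyz: "T = {x, y, z}" "rainbow col x y z" unfolding triangles_def by auto
      have "\<exists>u y z. T = {u, y, z} \<and> rainbow col u y z \<and> col u y = b \<and> col u z = c"
      proof -
        have perm: "T = {y, z, x}" "T = {z, x, y}" "T = {x, z, y}" "T = {y, x, z}" "T = {z, y, x}" using xyz by auto
        have r: "rainbow col y z x" "rainbow col z x y" "rainbow col x z y" "rainbow col y x z" "rainbow col z y x"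
          using xyz(2) rainbow_swap12 rainbow_swap23 by blast+
        from cl[of x y] cl[of x z] cl[of y z] xyz(2)
        have "col x y = b \<and> col x z = c \<or> col x z = b \<and> col x y = c \<or> col y x = b \<and> col y z = c \<or>
          col y z = b \<and> col y x = c \<or> col z x = b \<and> col z y = c \<or> col z y = b \<and> col z x = c"
          unfolding rainbow_def using sym by metis
        then show ?thesis using xyz perm r by blast
      qed
      then obtain u y z where u: "T = {u, y, z}" "rainbow col u y z" "col u y = b" "col u z = c" by blast
      then have "T \<in> apex u" using T unfolding apex_def by blast
      moreover have "u \<in> D" using u T triangles_subset by blast
      ultimately show "T \<in> (\<Union>v\<in>D. apex v)" by blast
    qed
    moreover have "finite (\<Union>v\<in>D. apex v)" using D finite_triangles[OF D] unfolding apex_def by auto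
    ultimately have "card (triangles D) \<le> card (\<Union>v\<in>D. apex v)" by (intro card_mono)
    also have "\<dots> \<le> (\<Sum>v\<in>D. card (apex v))" by (rule card_UN_le[OF D])
    finally have "real (card (triangles D)) \<le> (\<Sum>v\<in>D. real (card (apex v)))" by (simp flip: of_nat_sum)
    also have "\<dots> \<le> (\<Sum>v\<in>D. K)" using True by (intro sum_mono) auto
    finally show ?thesis by (simp add: mult.commute)
  next
    case False
    then obtain v where v: "v \<in> D" "K < card (apex v)" by auto
    define Y where "Y = {y \<in> D. y \<noteq> v \<and> col v y = b}"
    define Z where "Z = {z \<in> D. z \<noteq> v \<and> col v z = c}"
    have fin: "finite Y" "finite Z" using D unfolding Y_def Z_def by auto
    have ap: "\<exists>y\<in>Y. \<exists>z\<in>Z. T = {v, y, z} \<and> y \<noteq> v \<and> z \<noteq> v" if "T \<in> apex v" for T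
    proof -
      obtain y z where "T = {v, y, z}" "rainbow col v y z" "col v y = b" "col v z = c" "T \<in> triangles D"
        using \<open>T \<in> apex v\<close> unfolding apex_def by blast
      then show ?thesis using rainbow_distinct[of v y z] triangles_subset[of T D] unfolding Y_def Z_def by auto
    qed
    have "card (apex v) \<le> card Y"
      by (rule card_star_le[OF fin(1), of _ D v]) (use ap in \<open>fastforce simp: apex_def\<close>)
    moreover have "card (apex v) \<le> card Z"
      by (rule card_star_le[OF fin(2), of _ D v]) (use ap in \<open>fastforce simp: apex_def\<close>)
    ultimately have pq: "K < card Y" "K < card Z" using v by linarith+
    then have pq16: "16 \<le> card Y" "16 \<le> card Z" using K by linarith+
    have small: "real (card Y) \<le> \<sigma>" "real (card Z) \<le> \<sigma>"
    proof -
      have "card Y \<le> card {x \<in> D. x \<noteq> v \<and> col v x \<noteq> a}" "card Z \<le> card {x \<in> D. x \<noteq> v \<and> col v x \<noteq> a}"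
        using D abc unfolding Y_def Z_def by (auto intro!: card_mono)
      then show "real (card Y) \<le> \<sigma>" "real (card Z) \<le> \<sigma>" using deg[OF v(1)] by linarith+
    qed
    define A where "A = {z \<in> Z. card Y \<le> 4 * card {y \<in> Y. col y z = b}}"
    define A' where "A' = {y \<in> Y. card Z \<le> 4 * card {z \<in> Z. col z y = c}}"
    \<comment> \<open>\<open>B\<close> is the heavy part of \<open>Q\<close>. Half of the budget
      \<open>K * card B\<close> pays for the terms in \<open>w\<close>, by \<open>LBK\<close> and
      \<open>K < card Q \<le> 6 * card B\<close>; the other half pays for the triangles inside
      \<open>Q\<close>, by \<open>12 * \<tau> \<le> K\<close>.\<close>
    have finish: ?thesis if B: "B \<subseteq> Q" "Q \<subseteq> D" "card Q \<le> 6 * card B" "K < card Q" "real (card Q) \<le> \<sigma>"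
      and w: "\<exists>w. real w \<le> 11 * \<sigma> \<and> real (card {T \<in> triangles D. T \<inter> B \<noteq> {}}) \<le> 3 * w + 64 * cross_bound w + card (triangles Q)" for B Q
    proof -
      obtain w where w: "real w \<le> 11 * \<sigma>" "real (card {T \<in> triangles D. T \<inter> B \<noteq> {}}) \<le> 3 * w + 64 * cross_bound w + card (triangles Q)"
        using w by blast
      have "B \<subseteq> D" using B by auto
      have "card B > 0" using B K by linarith
      have "12 * (3 * w + 64 * cross_bound w) \<le> K * K" using LBK[OF w(1)] by simp
      also have "K * K \<le> K * card Q" using B K by (intro mult_left_mono) auto
      also have "\<dots> \<le> K * (6 * card B)" using B(3) K by (intro mult_left_mono) auto
      finally have 1: "3 * w + 64 * cross_bound w \<le> K / 2 * card B" by simp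
      have "card (triangles Q) \<le> \<tau> * card Q" using tau B by blast
      also have "\<dots> \<le> \<tau> * (6 * card B)" using B(3) K by (intro mult_left_mono) auto
      also have "\<dots> = 12 * \<tau> * (card B / 2)" by simp
      also have "\<dots> \<le> K * (card B / 2)" using K by (intro mult_right_mono) auto
      finally have 2: "real (card {T \<in> triangles D. T \<inter> B \<noteq> {}}) \<le> K * card B" using 1 w(2) by simp
      have lt: "card (D - B) < card D" using \<open>card B > 0\<close> \<open>B \<subseteq> D\<close> D
        by (intro psubset_card_mono) (auto simp: card_gt_0_iff)
      have IH: "real (card (triangles (D - B))) \<le> K * card (D - B)"
      proof (rule less.hyps[OF lt])
        show "finite (D - B)" using D by simp
        fix u assume u: "u \<in> D - B"
        have "card {x \<in> D - B. x \<noteq> u \<and> col u x \<noteq> a} \<le> card {x \<in> D. x \<noteq> u \<and> col u x \<noteq> a}"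
          using D by (intro card_mono) auto
        then show "real (card {x \<in> D - B. x \<noteq> u \<and> col u x \<noteq> a}) \<le> \<sigma>" using deg[of u] u by force
      qed (use tau in blast)
      have "triangles D \<subseteq> triangles (D - B) \<union> {T \<in> triangles D. T \<inter> B \<noteq> {}}"
      proof
        fix T assume T: "T \<in> triangles D"
        show "T \<in> triangles (D - B) \<union> {T \<in> triangles D. T \<inter> B \<noteq> {}}"
          using T triangles_Int[OF T, of "D - B"] triangles_subset[OF T] by blast
      qed
      then have "card (triangles D) \<le> card (triangles (D - B) \<union> {T \<in> triangles D. T \<inter> B \<noteq> {}})"
        using D finite_triangles by (intro card_mono) auto
      also have "\<dots> \<le> card (triangles (D - B)) + card {T \<in> triangles D. T \<inter> B \<noteq> {}}" by (rule card_Un_le)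
      finally have "real (card (triangles D)) \<le> K * card (D - B) + K * card B" using IH 2 by linarith
      also have "\<dots> = K * (card (D - B) + card B)" by (simp add: algebra_simps)
      also have "card (D - B) + card B = card D"
        using card_Diff_subset[of B D] card_mono[OF D \<open>B \<subseteq> D\<close>] \<open>B \<subseteq> D\<close> D finite_subset by fastforce
      finally show ?thesis .
    qed
    \<comment> \<open>An edge of colour \<open>a\<close> between \<open>Y\<close> and
      \<open>Z\<close> is rainbow with \<open>v\<close>.\<close>
    have a1: "card {y \<in> Y. col y z = a} \<le> 1" if "z \<in> Z" for z
    proof (rule card_le_one_if_unique)
      fix y y' assume "y \<in> {y \<in> Y. col y z = a}" "y' \<in> {y \<in> Y. col y z = a}"
      then have "rainbow col v z y" "rainbow col v z y'" using that abc sym[of z] unfolding rainbow_def Y_def Z_def by auto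
      then show "y = y'" by (rule third_unique)
    qed
    define eb ec where "eb = (\<Sum>z\<in>Z. card {y \<in> Y. col y z = b})" and "ec = (\<Sum>z\<in>Z. card {y \<in> Y. col y z = c})"
    have "card Y \<le> card {y \<in> Y. col y z = b} + card {y \<in> Y. col y z = c} + 1" if "z \<in> Z" for z
    proof -
      have "Y \<subseteq> {y \<in> Y. col y z = b} \<union> {y \<in> Y. col y z = c} \<union> {y \<in> Y. col y z = a}" using cl by auto
      then have "card Y \<le> card ({y \<in> Y. col y z = b} \<union> {y \<in> Y. col y z = c} \<union> {y \<in> Y. col y z = a})"
        using fin by (intro card_mono) auto
      also have "\<dots> \<le> card {y \<in> Y. col y z = b} + card {y \<in> Y. col y z = c} + card {y \<in> Y. col y z = a}"
        by (meson card_Un_le add_le_mono le_refl le_trans)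
      finally show ?thesis using a1[OF that] by linarith
    qed
    then have "(\<Sum>z\<in>Z. card Y) \<le> (\<Sum>z\<in>Z. card {y \<in> Y. col y z = b} + card {y \<in> Y. col y z = c} + 1)"
      by (rule sum_mono)
    then have e: "card Y * card Z \<le> eb + ec + card Z"
      unfolding eb_def ec_def sum.distrib by (simp add: mult.commute)
    have e4: "4 * card Z \<le> card Y * card Z" using pq16 by (intro mult_right_mono) auto
    \<comment> \<open>Colours \<open>b\<close> and \<open>c\<close> together cover at least 3/4 of
      the pairs in \<open>Y \<times> Z\<close>, so the more frequent one covers at least
      3/8.\<close>
    have sum8: "3 * (card Y * card Z) \<le> 8 * eb \<or> 3 * (card Y * card Z) \<le> 8 * ec"
    proof (cases "ec \<le> eb")
      case True
      then have "3 * (card Y * card Z) \<le> 8 * eb" using e e4 by linarith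
      then show ?thesis ..
    next
      case False
      then have "3 * (card Y * card Z) \<le> 8 * ec" using e e4 by linarith
      then show ?thesis ..
    qed
    have "Y \<subseteq> D" "Z \<subseteq> D" unfolding Y_def Z_def by auto
    from sum8 show ?thesis
    proof
      assume "3 * (card Y * card Z) \<le> 8 * eb"
      then have "card Z \<le> 6 * card A" unfolding A_def eb_def
        using pq16 fin by (intro card_heavy_ge) (auto intro: card_mono)
      moreover have "A \<subseteq> Z" unfolding A_def by auto
      ultimately show ?thesis
        using heavy_part_bound[OF D v(1) abc deg Y_def Z_def pq16(1) A_def] pq small \<open>Z \<subseteq> D\<close>
        by (intro finish[of A Z]) auto
    next
      \<comment> \<open>The mirror image: exchange \<open>b\<close> with \<open>c\<close> and
        \<open>Y\<close> with \<open>Z\<close>.\<close>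
      assume *: "3 * (card Y * card Z) \<le> 8 * ec"
      have "ec = (\<Sum>y\<in>Y. card {z \<in> Z. col z y = c})" unfolding ec_def
        using fin sym by (subst sum_multicount_gen[of Z Y "\<lambda>z y. col y z = c"]) auto
      then have "card Y \<le> 6 * card A'" unfolding A'_def
        using pq16 fin * by (intro card_heavy_ge) (auto intro: card_mono simp: mult.commute)
      moreover have "A' \<subseteq> Y" unfolding A'_def by auto
      ultimately show ?thesis
        using heavy_part_bound[OF D v(1) abc(2,1) abc(3)[symmetric] abc(4,6,5) deg Z_def Y_def pq16(2) A'_def] pq small \<open>Y \<subseteq> D\<close>
        by (intro finish[of A' Y]) auto
    qed
  qed
qed

section \<open>The induction on the number of vertices\<close>

text \<open>With \<open>u = m powr 0.1\<close>, the estimates \<open>ln u \<le> u\<close> and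
  \<open>ln 2 \<ge> 1 / 2\<close> give \<open>log 2 m \<le> 20 * u\<close>; then 64 * (9 * 20 + 24)
  + 3 = 13059 is rounded up.\<close>

lemma cross_bound_le_power:
  assumes "1 \<le> m"
  shows "64 * cross_bound m + 3 * m \<le> 14000 * m powr 0.1 * m"
proof -
  define u where "u = real m powr 0.1"
  have u1: "1 \<le> u" unfolding u_def using assms by (intro ge_one_powr_ge_zero) auto
  have "ln (real m) = 10 * ln u" unfolding u_def using assms by (simp add: ln_powr)
  also have "\<dots> \<le> 10 * u" using ln_le_minus_one[of u] u1 by linarith
  finally have "log 2 m * ln 2 \<le> 10 * u" by (simp add: log_def)
  moreover have "1 / 2 * log 2 m \<le> ln 2 * log 2 m"
    using ln_le_minus_one[of "1 / 2 :: real"] assms by (intro mult_right_mono) (auto simp: ln_div)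
  ultimately have "log 2 m \<le> 20 * u" by (simp add: mult.commute)
  then have "64 * (9 * log 2 m + 24) + 3 \<le> 14000 * u" using u1 by argo
  then have "(64 * (9 * log 2 m + 24) + 3) * m \<le> 14000 * u * m" by (intro mult_right_mono) auto
  then show ?thesis unfolding cross_bound_def u_def by (simp add: algebra_simps)
qed

text \<open>A triangle that avoids \<open>v\<close> and is seen from \<open>v\<close> in a single
  colour lies in \<open>N\<close> or in \<open>S - N\<close>. The others form the star at
  \<open>v\<close> or run between neighbourhoods.\<close>

lemma split_bound:
  assumes S: "finite S" and N: "N = {x \<in> S. x \<noteq> v \<and> col v x = i}"
  shows "real (card (triangles S)) \<le> card (triangles N) + card (triangles (S - N)) + card S + 64 * cross_bound (card S)"
proof -
  let ?V = "{T \<in> triangles S. v \<in> T}" and ?C = "{T \<in> triangles (S - {v}). \<not> (\<exists>i. \<forall>x\<in>T. col v x = i)}"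
  have "triangles S \<subseteq> triangles N \<union> triangles (S - N) \<union> ?V \<union> ?C"
  proof
    fix T assume T: "T \<in> triangles S"
    show "T \<in> triangles N \<union> triangles (S - N) \<union> ?V \<union> ?C"
    proof (cases "v \<in> T")
      case True then show ?thesis using T by simp
    next
      case False
      then have T': "T \<in> triangles (S - {v})" using T triangles_Int[OF T, of "S - {v}"] triangles_subset[OF T] by blast
      show ?thesis
      proof (cases "\<exists>j. \<forall>x\<in>T. col v x = j")
        case True
        then obtain j where j: "\<forall>x\<in>T. col v x = j" by auto
        have "T \<subseteq> N \<or> T \<subseteq> S - N"
          using j triangles_subset[OF T'] unfolding N by (cases "j = i") auto
        then show ?thesis using triangles_Int[OF T] by blast
      next
        case False then show ?thesis using T' by blast
      qed
    qed
  qed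
  moreover have "finite (triangles N \<union> triangles (S - N) \<union> ?V \<union> ?C)"
    using finite_triangles[of N] finite_triangles[of "S - N"] finite_triangles[OF S] finite_triangles[of "S - {v}"] S unfolding N by simp
  ultimately have "card (triangles S) \<le> card (triangles N \<union> triangles (S - N) \<union> ?V \<union> ?C)" by (intro card_mono)
  also have "\<dots> \<le> card (triangles N) + card (triangles (S - N)) + card ?V + card ?C"
    by (meson card_Un_le add_le_mono le_refl le_trans)
  finally show ?thesis
    using card_triangles_at_le[OF S, of v] between_neighbourhoods_bound[OF S, of v] by linarith
qed

text \<open>
  If \<open>k x \<noteq> k y\<close> and \<open>x y\<close> had the third colour, almost every vertex would form a rainbow triangle with \<open>x y\<close>.
\<close>

lemma dominated_bound:
  fixes \<sigma> \<tau> K :: real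
  assumes S: "finite S" "2 * \<sigma> + 1 < card S"
    and k: "\<And>x. x \<in> S \<Longrightarrow> k x < 3" "\<And>x. x \<in> S \<Longrightarrow> card (S - {y \<in> S. y \<noteq> x \<and> col x y = k x}) < \<sigma>"
    and tau: "\<And>Q. Q \<subseteq> S \<Longrightarrow> real (card Q) \<le> \<sigma> \<Longrightarrow> real (card (triangles Q)) \<le> \<tau> * card Q"
    and K: "16 \<le> K" "12 * \<tau> \<le> K" "0 \<le> \<tau>"
    and LBK: "\<And>w. real w \<le> 11 * \<sigma> \<Longrightarrow> 12 * (3 * w + 64 * cross_bound w) \<le> K * K"
  shows "real (card (triangles S)) \<le> cross_bound (card S) + 3 * (K * card S)"
proof -
  let ?N = "\<lambda>x. S - {y \<in> S. y \<noteq> x \<and> col x y = k x}"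
  let ?M = "{T \<in> triangles S. \<not> (\<exists>i. \<forall>x\<in>T. k x = i)}"
  have M: "real (card ?M) \<le> cross_bound (card S)"
  proof (rule between_classes_bound[OF S(1) k(1)])
    fix x y assume xy: "x \<in> S" "y \<in> S" "k x \<noteq> k y"
    show "col x y = k x \<or> col x y = k y"
    proof (rule ccontr)
      assume c: "\<not> (col x y = k x \<or> col x y = k y)"
      let ?U = "{u \<in> S. col x u = k x \<and> col y u = k y}"
      have "card ?U \<le> 1"
      proof (rule card_le_one_if_unique)
        fix u w assume "u \<in> ?U" "w \<in> ?U"
        then have "rainbow col x y u" "rainbow col x y w" using c xy(3) unfolding rainbow_def by auto
        then show "u = w" by (rule third_unique)
      qed
      moreover have "card S \<le> card (?N x \<union> ?N y \<union> ?U)" using S by (intro card_mono) auto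
      moreover have "card (?N x \<union> ?N y \<union> ?U) \<le> card (?N x) + card (?N y) + card ?U"
        by (meson card_Un_le add_le_mono le_refl le_trans)
      ultimately show False using k(2)[OF xy(1)] k(2)[OF xy(2)] S(2) by linarith
    qed
  qed
  \<comment> \<open>Inside the group \<open>D i\<close> every vertex sees fewer than \<sigma>
    vertices in a colour other than \<open>i\<close>, so \<open>sparse_bound\<close> applies with
    \<open>a = i\<close>.\<close>
  define D where "D = (\<lambda>i. {x \<in> S. k x = i})"
  have D: "D i \<subseteq> S" "finite (D i)" for i using S unfolding D_def by auto
  have RD: "real (card (triangles (D i))) \<le> K * card S" if i: "i < 3" for i
  proof -
    have "\<exists>b c. i \<noteq> b \<and> i \<noteq> c \<and> b \<noteq> c \<and> b < 3 \<and> c < (3::nat)"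
    proof -
      have "i = 0 \<or> i = 1 \<or> i = 2" using i by linarith
      then show ?thesis
      proof (elim disjE)
        assume "i = 0" then show ?thesis by (intro exI[of _ 1] exI[of _ 2]) auto
      next
        assume "i = 1" then show ?thesis by (intro exI[of _ 0] exI[of _ 2]) auto
      next
        assume "i = 2" then show ?thesis by (intro exI[of _ 0] exI[of _ 1]) auto
      qed
    qed
    then obtain b c where bc: "i \<noteq> b" "i \<noteq> c" "b \<noteq> c" "b < 3" "c < 3" by blast
    have "real (card (triangles (D i))) \<le> K * card (D i)"
    proof (rule sparse_bound[OF D(2) bc(1-3) i bc(4,5) _ _ K LBK])
      fix u assume u: "u \<in> D i"
      then have "card {x \<in> D i. x \<noteq> u \<and> col u x \<noteq> i} \<le> card (?N u)"
        using S by (intro card_mono) (auto simp: D_def)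
      then show "real (card {x \<in> D i. x \<noteq> u \<and> col u x \<noteq> i}) \<le> \<sigma>" using k(2)[of u] u D(1) by force
    next
      fix Q assume "Q \<subseteq> D i" "real (card Q) \<le> \<sigma>"
      then show "real (card (triangles Q)) \<le> \<tau> * card Q" using tau[of Q] D(1) by blast
    qed
    also have "\<dots> \<le> K * card S" using K card_mono[OF S(1) D(1)[of i]] by (intro mult_left_mono) auto
    finally show ?thesis .
  qed
  have "triangles S \<subseteq> ?M \<union> (triangles (D 0) \<union> triangles (D 1) \<union> triangles (D 2))"
  proof
    fix T assume T: "T \<in> triangles S"
    show "T \<in> ?M \<union> (triangles (D 0) \<union> triangles (D 1) \<union> triangles (D 2))"
    proof (cases "\<exists>i. \<forall>x\<in>T. k x = i")
      case True
      then obtain i where i: "\<forall>x\<in>T. k x = i" by auto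
      obtain x where "x \<in> T" using T unfolding triangles_def by auto
      then have "i < 3" using i k(1)[of x] triangles_subset[OF T] by auto
      then have "i = 0 \<or> i = 1 \<or> i = 2" by linarith
      moreover have "T \<subseteq> D i" using i triangles_subset[OF T] unfolding D_def by auto
      ultimately show ?thesis using triangles_Int[OF T] by blast
    qed (use T in simp)
  qed
  moreover have "finite (?M \<union> (triangles (D 0) \<union> triangles (D 1) \<union> triangles (D 2)))"
    using finite_triangles[OF S(1)] finite_triangles[OF D(2)] by simp
  ultimately have "card (triangles S) \<le> card (?M \<union> (triangles (D 0) \<union> triangles (D 1) \<union> triangles (D 2)))" by (intro card_mono)
  also have "\<dots> \<le> card ?M + (card (triangles (D 0)) + card (triangles (D 1)) + card (triangles (D 2)))"
    by (meson card_Un_le add_le_mono le_refl le_trans)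
  finally show ?thesis using M RD[of 0] RD[of 1] RD[of 2] by simp
qed

text \<open>Two requirements on the threshold \<sigma> meet at order \<open>m powr 0.7\<close>: the
  gain \<sigma> times \<open>m powr 0.4\<close> of a split must cover an error of order
  \<open>m powr 1.1\<close>, and a set of size O(\<sigma>) costs \<sigma> times
  \<open>m powr 0.1\<close>, which must stay within the order of \<open>K * K\<close> with
  \<open>K\<close> of order \<open>m powr 0.4\<close>.\<close>

lemma card_triangles_le:
  assumes "finite S"
  shows "real (card (triangles S)) \<le> 10 ^ 10 * real (card S) powr 1.4"
  using assms
proof (induction "card S" arbitrary: S rule: less_induct)
  case less
  note S = less.prems
  define m where "m = card S"
  \<comment> \<open>In terms of \<open>u\<close> all exponents are integers: \<open>m\<close>,
    \<open>m powr 0.4\<close>, \<open>m powr 1.4\<close> are \<open>u ^ 10\<close>,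
    \<open>u ^ 4\<close>, \<open>u ^ 14\<close>.\<close>
  define u where "u = real m powr 0.1"
  \<comment> \<open>The constant makes the gain \<open>10 ^ 10 * (0.2 * \<sigma> * u ^ 4)\<close>
    equal to \<open>14000 * u ^ 11\<close>, the bound for the error of a split.\<close>
  define \<sigma> where "\<sigma> = 7 / 10 ^ 6 * u ^ 7"
  consider "m = 0" | "1 \<le> m" "m \<le> 3" | "4 \<le> m" by linarith
  then show ?case
  proof cases
    case 1
    then have "triangles S = {}" using S unfolding m_def triangles_def by auto
    then show ?thesis by simp
  next
    case 2
    have "triangles S \<subseteq> Pow S" using triangles_subset by blast
    then have "card (triangles S) \<le> 2 ^ m" using S card_mono[of "Pow S" "triangles S"] unfolding m_def by (simp add: card_Pow)
    also have "\<dots> \<le> 2 ^ 3" using 2 by (intro power_increasing) auto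
    finally have "real (card (triangles S)) \<le> 8" by simp
    moreover have "1 \<le> real (card S) powr 1.4" using 2 unfolding m_def by (intro ge_one_powr_ge_zero) auto
    ultimately show ?thesis by simp
  next
    case 3
    have u1: "1 \<le> u" unfolding u_def using 3 by (intro ge_one_powr_ge_zero) auto
    have um: "u ^ 10 = m" and u4: "real m powr 0.4 = u ^ 4" and u14: "real m powr 1.4 = u ^ 14"
      unfolding u_def using 3 by (simp_all add: powr_power)
    have upos: "0 < u" using u1 by simp
    have s0: "0 < \<sigma>" unfolding \<sigma>_def using upos by simp
    have "u ^ 7 \<le> u ^ 10" using u1 by (intro power_increasing) auto
    then have sm: "\<sigma> \<le> 7 / 10 ^ 6 * m" unfolding \<sigma>_def um[symmetric] by simp
    have LBm: "64 * cross_bound m + 3 * m \<le> 14000 * u ^ 11"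
    proof -
      have "u ^ 11 = u * m" unfolding um[symmetric] by (simp add: eval_nat_numeral)
      then show ?thesis using cross_bound_le_power[of m] 3 unfolding u_def[symmetric] by (simp add: mult.assoc)
    qed
    show ?thesis
    proof (cases "\<exists>v\<in>S. \<exists>i<3. \<sigma> \<le> card {x \<in> S. x \<noteq> v \<and> col v x = i} \<and> \<sigma> \<le> card (S - {x \<in> S. x \<noteq> v \<and> col v x = i})")
      case True
      then obtain v i where v: "v \<in> S" "\<sigma> \<le> card {x \<in> S. x \<noteq> v \<and> col v x = i}"
        "\<sigma> \<le> card (S - {x \<in> S. x \<noteq> v \<and> col v x = i})" by blast
      define N where "N = {x \<in> S. x \<noteq> v \<and> col v x = i}"
      have NS: "N \<subseteq> S" "finite N" using S unfolding N_def by auto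
      have Nc: "card (S - N) + card N = m"
        using card_Diff_subset[OF NS(2,1)] card_mono[OF S NS(1)] unfolding m_def by linarith
      have pos: "card N > 0" "card (S - N) > 0" using v s0 unfolding N_def by linarith+
      have IH: "real (card (triangles N)) \<le> 10 ^ 10 * real (card N) powr 1.4"
        "real (card (triangles (S - N))) \<le> 10 ^ 10 * real (card (S - N)) powr 1.4"
        using less.hyps[of N] less.hyps[of "S - N"] pos Nc NS S unfolding m_def by auto
      have gain: "real (card N) powr 1.4 + real (card (S - N)) powr 1.4 + 0.2 * \<sigma> * u ^ 4 \<le> u ^ 14"
      proof -
        have *: "a powr 1.4 + b powr 1.4 + 0.2 * \<sigma> * u ^ 4 \<le> u ^ 14"
          if "\<sigma> \<le> a" "a \<le> b" "a + b = real m" for a b :: real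
        proof -
          have "a powr 1.4 + b powr 1.4 + 0.2 * a * u ^ 4 \<le> u ^ 14"
          proof -
            have "real m - a = b" "0 \<le> a" "a \<le> m / 2" using that s0 by linarith+
            then show ?thesis using powr_split_gain[of a m] unfolding u4 u14 by simp
          qed
          moreover have "\<sigma> * u ^ 4 \<le> a * u ^ 4" using that upos by (intro mult_right_mono) auto
          ultimately show ?thesis by linarith
        qed
        have "real (card N) + real (card (S - N)) = real m" using Nc by linarith
        then show ?thesis
          using *[of "card N" "card (S - N)"] *[of "card (S - N)" "card N"] v
          unfolding N_def[symmetric] by linarith
      qed
      have "\<sigma> * u ^ 4 = 7 / 10 ^ 6 * u ^ 11" unfolding \<sigma>_def by (simp add: eval_nat_numeral)
      then have "10 ^ 10 * (0.2 * \<sigma> * u ^ 4) = 14000 * u ^ 11" by simp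
      moreover have "real (card (triangles S)) \<le> card (triangles N) + card (triangles (S - N)) + m + 64 * cross_bound m"
        using split_bound[OF S N_def] unfolding m_def .
      ultimately have "real (card (triangles S)) \<le> 10 ^ 10 * (real (card N) powr 1.4 + real (card (S - N)) powr 1.4 + 0.2 * \<sigma> * u ^ 4)"
        using IH LBm unfolding distrib_left by linarith
      also have "\<dots> \<le> 10 ^ 10 * u ^ 14" using gain by (intro mult_left_mono) auto
      finally show ?thesis unfolding m_def[symmetric] u14 .
    next
      case False
      let ?N = "\<lambda>v i. {x \<in> S. x \<noteq> v \<and> col v x = i}"
      \<comment> \<open>Otherwise all three neighbourhoods of \<open>v\<close> are smaller than
        \<sigma> and cannot exhaust \<open>S\<close>.\<close>
      have "\<exists>i<3. card (S - ?N v i) < \<sigma>" if v: "v \<in> S" for v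
      proof (rule ccontr)
        assume "\<not> ?thesis"
        then have lt: "card (?N v i) < \<sigma>" if "i < 3" for i using False v that by force
        have "S \<subseteq> {v} \<union> ?N v 0 \<union> ?N v 1 \<union> ?N v 2"
        proof
          fix x assume "x \<in> S"
          moreover have "col v x = 0 \<or> col v x = 1 \<or> col v x = 2" using lt3[of v x] by linarith
          ultimately show "x \<in> {v} \<union> ?N v 0 \<union> ?N v 1 \<union> ?N v 2" by blast
        qed
        then have "m \<le> card ({v} \<union> ?N v 0 \<union> ?N v 1 \<union> ?N v 2)"
          using S unfolding m_def by (intro card_mono) auto
        also have "\<dots> \<le> card {v} + card (?N v 0) + card (?N v 1) + card (?N v 2)"
          by (meson card_Un_le add_le_mono le_refl le_trans)
        finally have "m \<le> 1 + card (?N v 0) + card (?N v 1) + card (?N v 2)" by simp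
        then have "real m \<le> 1 + 3 * \<sigma>" using lt[of 0] lt[of 1] lt[of 2] by simp
        then show False using sm 3 by simp
      qed
      then obtain k where k: "\<And>v. v \<in> S \<Longrightarrow> k v < 3" "\<And>v. v \<in> S \<Longrightarrow> card (S - ?N v (k v)) < \<sigma>" by metis
      \<comment> \<open>\<open>3 * (K * m)\<close> uses three quarters of
        \<open>10 ^ 10 * u ^ 14\<close>; the rest absorbs \<open>cross_bound m\<close>.\<close>
      define K where "K = 25 * 10 ^ 8 * u ^ 4"
      define \<tau> where "\<tau> = 10 ^ 10 * \<sigma> powr 0.4"
      have u4ge: "1 \<le> u ^ 4" using u1 by simp
      \<comment> \<open>The factor 48 is what \<open>12 * \<tau> \<le> K\<close> requires. Taking
        fifth powers removes the fractional exponent.\<close>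
      have "\<sigma> powr 0.4 \<le> u ^ 4 / 48"
      proof (rule power_le_imp_le_base[of _ 4])
        have "(\<sigma> powr 0.4) ^ Suc 4 = \<sigma>\<^sup>2" using s0 by (simp add: powr_power)
        also have "\<dots> \<le> (7 / 10 ^ 6 * u ^ 10)\<^sup>2" using sm s0 um by (intro power_mono) auto
        also have "\<dots> \<le> (u ^ 4 / 48) ^ Suc 4"
          using upos by (simp add: power_mult_distrib power_divide flip: power_mult)
        finally show "(\<sigma> powr 0.4) ^ Suc 4 \<le> (u ^ 4 / 48) ^ Suc 4" .
      qed simp
      then have K: "16 \<le> K" "12 * \<tau> \<le> K" "0 \<le> \<tau>" using u4ge unfolding K_def \<tau>_def by simp_all
      have tau: "real (card (triangles Q)) \<le> \<tau> * card Q" if "Q \<subseteq> S" "real (card Q) \<le> \<sigma>" for Q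
      proof -
        have "card Q < card S" using that sm 3 unfolding m_def by simp
        then have "real (card (triangles Q)) \<le> 10 ^ 10 * real (card Q) powr 1.4"
          using less.hyps that S finite_subset by blast
        also have "\<dots> = 10 ^ 10 * real (card Q) powr 0.4 * card Q"
          using powr_mult_base[of "real (card Q)" "0.4"] by (simp add: mult.commute)
        also have "\<dots> \<le> \<tau> * card Q" unfolding \<tau>_def using that
          by (intro mult_right_mono mult_left_mono powr_mono2) auto
        finally show ?thesis .
      qed
      have LBK: "12 * (3 * w + 64 * cross_bound w) \<le> K * K" if w: "real w \<le> 11 * \<sigma>" for w
      proof (cases "w = 0")
        case True then show ?thesis by (simp add: cross_bound_def)
      next
        case False
        have "w \<le> m" using w sm by simp
        then have "w powr 0.1 \<le> u" unfolding u_def by (intro powr_mono2) auto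
        then have "14000 * w powr 0.1 * w \<le> 14000 * u * (11 * \<sigma>)" using w upos by (intro mult_mono) auto
        then have "3 * w + 64 * cross_bound w \<le> 14000 * u * (11 * \<sigma>)" using cross_bound_le_power[of w] False by linarith
        then have "12 * (3 * w + 64 * cross_bound w) \<le> 12 * (14000 * u * (11 * \<sigma>))" by (intro mult_left_mono) auto
        also have "\<dots> = 12.936 * u ^ 8" unfolding \<sigma>_def by (simp add: eval_nat_numeral)
        also have "\<dots> \<le> (25 * 10 ^ 8)\<^sup>2 * u ^ 8" using upos by (intro mult_right_mono) auto
        also have "\<dots> = K * K" unfolding K_def by (simp add: eval_nat_numeral)
        finally show ?thesis by simp
      qed
      have "2 * \<sigma> + 1 < card S" using sm 3 unfolding m_def by simp
      from dominated_bound[OF S this k tau K LBK]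
      have "real (card (triangles S)) \<le> cross_bound m + 3 * (K * m)" unfolding m_def .
      moreover have "cross_bound m \<ge> 0" using 3 unfolding cross_bound_def by simp
      moreover have "K * m = 25 * 10 ^ 8 * u ^ 14" unfolding K_def um[symmetric] by (simp flip: power_add)
      moreover have "u ^ 11 \<le> u ^ 14" using u1 by (intro power_increasing) auto
      ultimately have "real (card (triangles S)) \<le> 10 ^ 10 * u ^ 14" using LBm by simp
      then show ?thesis unfolding m_def[symmetric] u14 .
    qed
  qed
qed

end

subsection \<open>The cube colouring\<close>

text \<open>No carry occurs, since bit \<open>i\<close> is clear.\<close>

lemma bit_add_exp_iff:
  assumes "\<not> bit (x::nat) i"
  shows "bit (x + 2 ^ i) j \<longleftrightarrow> bit x j \<or> j = i"
proof -
  have "x + 2 ^ i = or x (2 ^ i)"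
    using assms by (intro disjunctive_add_eq_or bit_eqI) (auto simp: bit_and_iff bit_exp_iff)
  then show ?thesis by (auto simp: bit_or_iff bit_exp_iff)
qed

text \<open>The numbers below \<open>m\<close> are the cube points, and \<open>m + i\<close> is the extra vertex of coordinate \<open>i\<close>. The colour of an edge is given for \<open>a < b\<close>.\<close>

definition pair_colour :: "nat \<Rightarrow> nat \<Rightarrow> nat \<Rightarrow> nat \<Rightarrow> nat" where
  "pair_colour m k a b =
     (if b < m then (if \<exists>i<k. b = a + 2 ^ i \<and> \<not> bit a i then 3 else 1)
      else if a < m \<and> bit a (b - m) then 2 else 1)"

definition cube_colouring :: "nat \<Rightarrow> nat \<Rightarrow> nat set \<Rightarrow> nat" where
  "cube_colouring m k e = pair_colour m k (Min e) (Max e)"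

definition cube_triangle :: "nat \<Rightarrow> nat \<Rightarrow> nat \<Rightarrow> nat set" where
  "cube_triangle m i x = {x, x + 2 ^ i, m + i}"

lemma cube_colouring_pair: "a < b \<Longrightarrow> cube_colouring m k {a, b} = pair_colour m k a b"
  unfolding cube_colouring_def by simp

text \<open>Sorting the vertices matches \<open>pair_colour\<close>, which describes an edge by its
  smaller and larger end.\<close>

lemma rainbow_triangle_sorted:
  assumes "rainbow_triangle n c T"
  shows "\<exists>a b d. a < b \<and> b < d \<and> d < n \<and> T = {a, b, d} \<and>
    c {a, b} \<noteq> c {a, d} \<and> c {a, b} \<noteq> c {b, d} \<and> c {a, d} \<noteq> c {b, d}"
proof -
  define Q where "Q = (\<lambda>a b d. a < n \<and> b < n \<and> d < n \<and> a \<noteq> b \<and> a \<noteq> d \<and> b \<noteq> d \<and> T = {a, b, d} \<and>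
    c {a, b} \<noteq> c {a, d} \<and> c {a, b} \<noteq> c {b, d} \<and> c {a, d} \<noteq> c {b, d})"
  have s12: "Q b a d" and s23: "Q a d b" if "Q a b d" for a b d
    using that unfolding Q_def by (simp_all add: insert_commute)
  obtain x y z where "Q x y z" using assms unfolding rainbow_triangle_def Q_def by blast
  moreover from this have "x \<noteq> y" "x \<noteq> z" "y \<noteq> z" unfolding Q_def by auto
  ultimately have "\<exists>a b d. a < b \<and> b < d \<and> Q a b d"
    using s12 s23 by (metis linorder_neqE_nat)
  then show ?thesis unfolding Q_def by blast
qed

lemma rainbow_cube_iff:
  "rainbow_triangle (m + k) (cube_colouring m k) T \<longleftrightarrow>
    (\<exists>i<k. \<exists>x. \<not> bit x i \<and> x + 2 ^ i < m \<and> T = cube_triangle m i x)"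
proof
  assume "rainbow_triangle (m + k) (cube_colouring m k) T"
  from rainbow_triangle_sorted[OF this] obtain a b d where abd: "a < b" "b < d" "d < m + k" "T = {a, b, d}"
    and c': "cube_colouring m k {a, b} \<noteq> cube_colouring m k {a, d}"
      "cube_colouring m k {a, b} \<noteq> cube_colouring m k {b, d}"
      "cube_colouring m k {a, d} \<noteq> cube_colouring m k {b, d}"
    by metis
  note c = c'[unfolded cube_colouring_pair[OF abd(1)] cube_colouring_pair[OF abd(2)]
      cube_colouring_pair[OF less_trans[OF abd(1,2)]]]
  \<comment> \<open>Three cube points span only colours 1 and 3, and two extra vertices in a
    triangle leave only colours 1 and 2. So exactly the largest vertex is an extra one.\<close>
  have bm: "b < m" and dm: "\<not> d < m"
    using c abd unfolding pair_colour_def by (auto split: if_splits)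
  then have e: "pair_colour m k a d = (if bit a (d - m) then 2 else 1)"
    "pair_colour m k b d = (if bit b (d - m) then 2 else 1)"
    using abd unfolding pair_colour_def by auto
  then have "pair_colour m k a b = 3"
    using c bm unfolding pair_colour_def[of m k a b] by (auto split: if_splits)
  then obtain i where i: "i < k" "b = a + 2 ^ i" "\<not> bit a i"
    using bm unfolding pair_colour_def by (auto split: if_splits)
  have "bit a (d - m) \<noteq> bit b (d - m)" using c e by (auto split: if_splits)
  then have "d - m = i" using bit_add_exp_iff[OF i(3), of "d - m"] i(2) by auto
  then have "d = m + i" using dm by auto
  then show "\<exists>i<k. \<exists>x. \<not> bit x i \<and> x + 2 ^ i < m \<and> T = cube_triangle m i x"
    using i bm abd unfolding cube_triangle_def by blast
next
  assume "\<exists>i<k. \<exists>x. \<not> bit x i \<and> x + 2 ^ i < m \<and> T = cube_triangle m i x"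
  then obtain i x where i: "i < k" "\<not> bit x i" "x + 2 ^ i < m" "T = {x, x + 2 ^ i, m + i}"
    unfolding cube_triangle_def by blast
  have lt: "x < x + 2 ^ i" "x + 2 ^ i < m + i" "x < m + i" using i by auto
  have "cube_colouring m k {x, x + 2 ^ i} = 3"
    unfolding cube_colouring_pair[OF lt(1)] pair_colour_def using i by auto
  moreover have "cube_colouring m k {x, m + i} = 1"
    unfolding cube_colouring_pair[OF lt(3)] pair_colour_def using i by auto
  moreover have "cube_colouring m k {x + 2 ^ i, m + i} = 2"
    unfolding cube_colouring_pair[OF lt(2)] pair_colour_def using i bit_add_exp_iff[OF i(2), of i] by auto
  ultimately show "rainbow_triangle (m + k) (cube_colouring m k) T"
    unfolding rainbow_triangle_def using i lt
    by (intro exI[of _ x] exI[of _ "x + 2 ^ i"] exI[of _ "m + i"]) auto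
qed

text \<open>An edge inside the cube has \<open>x\<close> as smaller end and \<open>2 ^ i\<close> as
  difference. An edge to an extra vertex reveals \<open>i\<close>, and bit \<open>i\<close> of its
  other end tells whether this is \<open>x\<close> or \<open>x + 2 ^ i\<close>.\<close>

lemma cube_triangle_edge_unique:
  assumes "\<not> bit x i" "x + 2 ^ i < m" "\<not> bit y j" "y + 2 ^ j < m"
    and pq: "p < q" "{p, q} \<subseteq> cube_triangle m i x" "{p, q} \<subseteq> cube_triangle m j y"
  shows "i = j \<and> x = y"
proof (cases "q < m")
  case True
  then have "p = x" "q = x + 2 ^ i" "p = y" "q = y + 2 ^ j"
    using pq assms unfolding cube_triangle_def by auto
  then show ?thesis by simp
next
  case False
  then have q: "q = m + i" "q = m + j" using pq assms unfolding cube_triangle_def by auto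
  then have "p = x \<or> p = x + 2 ^ i" "p = y \<or> p = y + 2 ^ i"
    using pq unfolding cube_triangle_def by auto
  then show ?thesis
    using q assms(1,3) bit_add_exp_iff[of x i i] bit_add_exp_iff[of y i i] by auto
qed

lemma almost_3_gallai_cube: "almost_3_gallai (m + k) (cube_colouring m k)"
  unfolding almost_3_gallai_def
proof (intro allI impI, rule ccontr)
  fix T1 T2
  assume T: "rainbow_triangle (m + k) (cube_colouring m k) T1" "rainbow_triangle (m + k) (cube_colouring m k) T2"
    "T1 \<noteq> T2" "\<not> card (T1 \<inter> T2) \<le> 1"
  obtain i x where 1: "\<not> bit x i" "x + 2 ^ i < m" "T1 = cube_triangle m i x"
    using T(1) unfolding rainbow_cube_iff by blast
  obtain j y where 2: "\<not> bit y j" "y + 2 ^ j < m" "T2 = cube_triangle m j y"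
    using T(2) unfolding rainbow_cube_iff by blast
  have "finite (T1 \<inter> T2)" unfolding 1 cube_triangle_def by simp
  then obtain p q where "p \<in> T1 \<inter> T2" "q \<in> T1 \<inter> T2" "p \<noteq> q"
    using T(4) card_le_Suc0_iff_eq[of "T1 \<inter> T2"] by auto
  then obtain p q where "p < q" "{p, q} \<subseteq> T1" "{p, q} \<subseteq> T2"
    by (metis Int_iff empty_subsetI insert_subset linorder_neqE_nat)
  then show False using cube_triangle_edge_unique[OF 1(1,2) 2(1,2)] 1(3) 2(3) T(3) by blast
qed

text \<open>The points below \<open>m\<close> are paired by flipping bit \<open>i\<close>. As
  \<open>m\<close> may be any number, points with bit \<open>i\<close> clear can lose their partner,
  but only the top \<open>2 ^ i\<close> ones.\<close>

lemma card_zero_bit_ge: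
  "m \<le> 2 * card {x. \<not> bit x i \<and> x + 2 ^ i < m} + 2 ^ i"
proof -
  let ?X = "{x. \<not> bit x i \<and> x + 2 ^ i < m}"
  have fin: "finite ?X" by (rule finite_subset[of _ "{..<m}"]) auto
  have "{..<m} \<subseteq> ?X \<union> (\<lambda>x. x + 2 ^ i) ` ?X \<union> {m - 2 ^ i..<m}"
  proof
    fix y assume y: "y \<in> {..<m}"
    show "y \<in> ?X \<union> (\<lambda>x. x + 2 ^ i) ` ?X \<union> {m - 2 ^ i..<m}"
    proof (cases "bit y i")
      case True
      then have odd: "odd (y div 2 ^ i)" by (simp add: bit_iff_odd)
      then have le: "2 ^ i \<le> y" by (metis div_less even_zero not_le)
      then have "y div 2 ^ i = Suc ((y - 2 ^ i) div 2 ^ i)" by (simp add: le_div_geq)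
      then have "\<not> bit (y - 2 ^ i) i" using odd by (simp add: bit_iff_odd)
      then have "y - 2 ^ i \<in> ?X" using y le by simp
      then show ?thesis using le by (intro UnI1 UnI2 image_eqI[of _ _ "y - 2 ^ i"]) auto
    qed (use y in auto)
  qed
  then have "card {..<m} \<le> card (?X \<union> (\<lambda>x. x + 2 ^ i) ` ?X \<union> {m - 2 ^ i..<m})"
    using fin by (intro card_mono) auto
  also have "\<dots> \<le> card ?X + card ((\<lambda>x. x + 2 ^ i) ` ?X) + card {m - 2 ^ i..<m}"
    by (meson card_Un_le add_le_mono le_refl le_trans)
  also have "\<dots> \<le> card ?X + card ?X + 2 ^ i"
    using card_image_le[OF fin, of "\<lambda>x. x + 2 ^ i"] by simp
  finally show ?thesis by simp
qed

lemma finite_rainbow_triangles: "finite (rainbow_triangles n c)"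
  by (rule finite_subset[of _ "Pow {..<n}"]) (auto simp: rainbow_triangles_def rainbow_triangle_def)

text \<open>Distinct pairs \<open>(i, x)\<close> give distinct triangles, and the losses
  \<open>2 ^ i\<close> over all directions sum to less than \<open>2 ^ k\<close>.\<close>

lemma card_rainbow_cube_ge:
  "real k * real m - 2 ^ k \<le> 2 * real (card (rainbow_triangles (m + k) (cube_colouring m k)))"
proof -
  let ?X = "\<lambda>i. {x. \<not> bit x i \<and> x + 2 ^ i < m}"
  let ?P = "SIGMA i:{..<k}. ?X i"
  have fin: "finite (?X i)" for i by (rule finite_subset[of _ "{..<m}"]) auto
  have inj: "inj_on (\<lambda>(i, x). cube_triangle m i x) ?P"
  proof (rule inj_onI, clarify)
    fix i x j y assume *: "\<not> bit x i" "x + 2 ^ i < m" "\<not> bit y j" "y + 2 ^ j < m"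
      "cube_triangle m i x = cube_triangle m j y"
    show "i = j \<and> x = y"
    proof (rule cube_triangle_edge_unique[OF *(1-4)])
      show "x < x + 2 ^ i" by simp
      show sub: "{x, x + 2 ^ i} \<subseteq> cube_triangle m i x" by (auto simp: cube_triangle_def)
      show "{x, x + 2 ^ i} \<subseteq> cube_triangle m j y" using sub unfolding *(5) .
    qed
  qed
  have "card ?P \<le> card (rainbow_triangles (m + k) (cube_colouring m k))"
    by (rule card_inj_on_le[OF inj _ finite_rainbow_triangles])
      (auto simp: rainbow_triangles_def rainbow_cube_iff)
  moreover have "card ?P = (\<Sum>i<k. card (?X i))" using fin by (simp add: card_SigmaI)
  ultimately have 1: "(\<Sum>i<k. real (card (?X i))) \<le> card (rainbow_triangles (m + k) (cube_colouring m k))"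
    by (simp flip: of_nat_sum)
  have "real k * real m = (\<Sum>i<k. real m)" by simp
  also have "\<dots> \<le> (\<Sum>i<k. 2 * real (card (?X i)) + 2 ^ i)"
  proof (rule sum_mono)
    fix i
    have "real m \<le> real (2 * card (?X i) + 2 ^ i)" using card_zero_bit_ge by (simp only: of_nat_le_iff)
    then show "real m \<le> 2 * real (card (?X i)) + 2 ^ i" by simp
  qed
  also have "\<dots> = 2 * (\<Sum>i<k. real (card (?X i))) + (\<Sum>i<k. 2 ^ i)"
    by (simp add: sum.distrib sum_distrib_left)
  also have "(\<Sum>i<k. 2 ^ i) \<le> (2::real) ^ k"
    using sum_gp_strict[of "2::real" k] by simp
  finally show ?thesis using 1 by simp
qed

lemma exists_many_rainbow_three_colours:
  assumes "2 \<le> n"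
  shows "\<exists>c. almost_3_gallai n c \<and> card (c ` Kn_edges n) \<le> 3 \<and>
    ((log 2 n - 1) * (n - log 2 n) - n) / 2 \<le> real (card (rainbow_triangles n c))"
proof -
  \<comment> \<open>Rounding down keeps the loss \<open>2 ^ k\<close> at most \<open>n\<close>,
    while the remaining \<open>m = n - k\<close> cube points still give \<open>k * m\<close> of
    order \<open>n * log 2 n\<close> with constant 1.\<close>
  define k where "k = nat \<lfloor>log 2 n\<rfloor>"
  have l1: "1 \<le> log 2 n" using assms by simp
  have k: "real k \<le> log 2 n" "log 2 n - 1 \<le> real k" unfolding k_def using l1 by linarith+
  have "(2::real) ^ k = 2 powr k" by (simp add: powr_realpow)
  also have "\<dots> \<le> 2 powr (log 2 n)" using k by (intro powr_mono) auto
  also have "\<dots> = n" using assms by simp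
  finally have kn: "2 ^ k \<le> real n" .
  moreover have "real k < 2 ^ k" by (rule of_nat_less_two_power)
  ultimately have "k \<le> n" by linarith
  define m where "m = n - k"
  have n: "m + k = n" unfolding m_def using \<open>k \<le> n\<close> by simp
  define c where "c = cube_colouring m k"
  have "c e \<in> {1, 2, 3}" for e unfolding c_def cube_colouring_def pair_colour_def by auto
  then have "c ` Kn_edges n \<subseteq> {1, 2, 3}" by blast
  then have "card (c ` Kn_edges n) \<le> card {1, 2, 3 :: nat}" by (intro card_mono) auto
  then have 3: "card (c ` Kn_edges n) \<le> 3" by simp
  have "log 2 n \<le> n"
    using log_le_cancel_iff[of 2 "real n" "2 ^ n"] assms of_nat_less_two_power[of n, where 'a = real]
    by (simp add: less_imp_le log_nat_power)
  then have "(log 2 n - 1) * (n - log 2 n) \<le> k * (real n - k)"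
    using k l1 by (intro mult_mono) auto
  also have "real n - k = m" using n by linarith
  finally have lower: "(log 2 n - 1) * (n - log 2 n) \<le> real k * m" .
  have "(A - E) / 2 \<le> D" if "A \<le> B" "B - C \<le> 2 * D" "C \<le> E" for A B C D E :: real
    using that by simp
  from this[OF lower card_rainbow_cube_ge kn]
  have "((log 2 n - 1) * (n - log 2 n) - n) / 2 \<le> real (card (rainbow_triangles n c))"
    unfolding n c_def .
  then show ?thesis using 3 almost_3_gallai_cube[of m k] unfolding n c_def by blast
qed

lemma half_n_log_n_eventually_le:
  assumes "\<epsilon> > 0"
  shows "\<forall>\<^sub>F n in sequentially. (1/2 - \<epsilon>) * real n * log 2 (real n) \<le> ((log 2 n - 1) * (n - log 2 n) - n) / 2"
  using assms by real_asymp

subsection \<open>Bounds for the extremal function\<close>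

text \<open>After merging, a rainbow triangle was already rainbow before, so the almost 3-Gallai
  condition survives. A random \<open>R\<close> contains \<alpha> but neither \<beta> nor \<gamma>
  with probability 1/8, and a second sample \<open>R'\<close> separates \<beta> from \<gamma> with
  probability 1/4, whence 32.\<close>

lemma merge_to_three_colours:
  assumes c: "almost_3_gallai n c"
  shows "\<exists>col :: nat \<Rightarrow> nat \<Rightarrow> nat. gallai3 col \<and>
    card (rainbow_triangles n c) \<le> 32 * card (gallai3.triangles col {..<n})"
proof -
  let ?F = "rainbow_triangles n c"
  have fin: "finite ?F" by (rule finite_rainbow_triangles)
  let ?U = "c ` Pow {..<n}"
  have "\<forall>T\<in>?F. \<exists>t. case t of (x, y, z) \<Rightarrow> x < n \<and> y < n \<and> z < n \<and> x \<noteq> y \<and> x \<noteq> z \<and> y \<noteq> z \<and> T = {x, y, z} \<and>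
      c {x, y} \<noteq> c {x, z} \<and> c {x, y} \<noteq> c {y, z} \<and> c {x, z} \<noteq> c {y, z}"
    unfolding rainbow_triangles_def rainbow_triangle_def by fastforce
  from bchoice[OF this] obtain t where t: "\<forall>T\<in>?F. case t T of (x, y, z) \<Rightarrow> x < n \<and> y < n \<and> z < n \<and> x \<noteq> y \<and> x \<noteq> z \<and> y \<noteq> z \<and> T = {x, y, z} \<and>
      c {x, y} \<noteq> c {x, z} \<and> c {x, y} \<noteq> c {y, z} \<and> c {x, z} \<noteq> c {y, z}" ..
  define \<alpha> \<beta> \<gamma> where "\<alpha> = (\<lambda>T. case t T of (x, y, z) \<Rightarrow> c {x, y})"
    and "\<beta> = (\<lambda>T. case t T of (x, y, z) \<Rightarrow> c {x, z})" and "\<gamma> = (\<lambda>T. case t T of (x, y, z) \<Rightarrow> c {y, z})"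
  have abc: "\<alpha> T \<noteq> \<beta> T \<and> \<alpha> T \<noteq> \<gamma> T \<and> \<beta> T \<noteq> \<gamma> T \<and> \<alpha> T \<in> ?U \<and> \<beta> T \<in> ?U \<and> \<gamma> T \<in> ?U" if "T \<in> ?F" for T
    using t that unfolding \<alpha>_def \<beta>_def \<gamma>_def by (cases "t T") fastforce
  have "\<exists>R. R \<subseteq> ?U \<and> card ?F \<le> 2 ^ 3 * card {T \<in> ?F. {\<alpha> T} \<subseteq> R \<and> {\<beta> T, \<gamma> T} \<inter> R = {}}"
    using fin abc by (intro exists_good_sample) auto
  then obtain R where R: "card ?F \<le> 2 ^ 3 * card {T \<in> ?F. {\<alpha> T} \<subseteq> R \<and> {\<beta> T, \<gamma> T} \<inter> R = {}}" by blast
  define G where "G = {T \<in> ?F. {\<alpha> T} \<subseteq> R \<and> {\<beta> T, \<gamma> T} \<inter> R = {}}"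
  have GF: "G \<subseteq> ?F" "finite G" using fin unfolding G_def by auto
  have "\<exists>R'. R' \<subseteq> ?U \<and> card G \<le> 2 ^ 2 * card {T \<in> G. {\<beta> T} \<subseteq> R' \<and> {\<gamma> T} \<inter> R' = {}}"
    using GF(2) abc[OF subsetD[OF GF(1)]] by (intro exists_good_sample) auto
  then obtain R' where R': "card G \<le> 2 ^ 2 * card {T \<in> G. {\<beta> T} \<subseteq> R' \<and> {\<gamma> T} \<inter> R' = {}}" by blast
  define h :: "nat \<Rightarrow> nat" where "h = (\<lambda>s. if s \<in> R then 0 else if s \<in> R' then 1 else 2)"
  \<comment> \<open>The default 0 off the edges creates no rainbow triple: a vertex outside
    \<open>{..<n}\<close> would give two pairs of colour 0.\<close>
  define col where "col = (\<lambda>x y. if x < n \<and> y < n \<and> x \<noteq> y then h (c {x, y}) else 0)"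
  have sym: "col x y = col y x" for x y unfolding col_def by (auto simp: insert_commute)
  have rb: "rainbow_triangle n c {x, y, z} \<and> x \<noteq> y \<and> z \<noteq> x \<and> z \<noteq> y" if r: "rainbow col x y z" for x y z
  proof -
    have ne: "x \<noteq> y" "x \<noteq> z" "y \<noteq> z" using r sym unfolding rainbow_def by auto
    have lt: "x < n" "y < n" "z < n" using r unfolding rainbow_def col_def by (auto split: if_splits)
    have "c {x, y} \<noteq> c {x, z}" "c {x, y} \<noteq> c {y, z}" "c {x, z} \<noteq> c {y, z}"
      using r ne lt unfolding rainbow_def col_def by auto
    then show ?thesis using ne lt unfolding rainbow_triangle_def by blast
  qed
  interpret gallai3 col
  proof
    show "col x y < 3" for x y unfolding col_def h_def by auto
    fix x y z w assume r: "rainbow col x y z" "rainbow col x y w"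
    show "z = w"
    proof (rule ccontr)
      assume "z \<noteq> w"
      then have "{x, y, z} \<noteq> {x, y, w}" using rb[OF r(1)] rb[OF r(2)] by auto
      then have "card ({x, y, z} \<inter> {x, y, w}) \<le> 1"
        using c rb[OF r(1)] rb[OF r(2)] unfolding almost_3_gallai_def by blast
      moreover have "card {x, y} \<le> card ({x, y, z} \<inter> {x, y, w})" by (intro card_mono) auto
      ultimately show False using rb[OF r(1)] by simp
    qed
  qed (rule sym)
  have "{T \<in> G. {\<beta> T} \<subseteq> R' \<and> {\<gamma> T} \<inter> R' = {}} \<subseteq> triangles {..<n}"
  proof
    fix T assume T: "T \<in> {T \<in> G. {\<beta> T} \<subseteq> R' \<and> {\<gamma> T} \<inter> R' = {}}"
    then have h: "h (\<alpha> T) = 0" "h (\<beta> T) = 1" "h (\<gamma> T) = 2" and "T \<in> ?F"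
      unfolding h_def G_def by auto
    obtain x y z where xyz: "t T = (x, y, z)" by (metis prod_cases3)
    then have *: "x < n" "y < n" "z < n" "x \<noteq> y" "x \<noteq> z" "y \<noteq> z" "T = {x, y, z}" using t \<open>T \<in> ?F\<close> by auto
    have "rainbow col x y z" using h * xyz unfolding rainbow_def col_def \<alpha>_def \<beta>_def \<gamma>_def by simp
    then show "T \<in> triangles {..<n}" using * unfolding triangles_def by blast
  qed
  then have "card {T \<in> G. {\<beta> T} \<subseteq> R' \<and> {\<gamma> T} \<inter> R' = {}} \<le> card (triangles {..<n})"
    by (intro card_mono finite_triangles) auto
  then have "card ?F \<le> 32 * card (triangles {..<n})" using R R' unfolding G_def[symmetric] by simp
  then show ?thesis using gallai3_axioms by blast
qed

lemma card_rainbow_triangles_le: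
  assumes "almost_3_gallai n c"
  shows "real (card (rainbow_triangles n c)) \<le> 32 * 10 ^ 10 * real n powr 1.4"
proof -
  obtain col :: "nat \<Rightarrow> nat \<Rightarrow> nat" where col: "gallai3 col" "card (rainbow_triangles n c) \<le> 32 * card (gallai3.triangles col {..<n})"
    using merge_to_three_colours[OF assms] by blast
  then show ?thesis using gallai3.card_triangles_le[OF col(1), of "{..<n}"] by simp
qed

lemma finite_tau3_set: "finite {card (rainbow_triangles n c) | c. almost_3_gallai n c}"
proof (rule finite_subset)
  have "rainbow_triangles n c \<subseteq> Pow {..<n}" for c
    by (auto simp: rainbow_triangles_def rainbow_triangle_def)
  then have "card (rainbow_triangles n c) \<le> card (Pow {..<n})" for c by (intro card_mono) auto
  then show "{card (rainbow_triangles n c) | c. almost_3_gallai n c} \<subseteq> {..card (Pow {..<n})}" by auto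
qed simp

lemma le_tau3: "almost_3_gallai n c \<Longrightarrow> card (rainbow_triangles n c) \<le> tau3 n"
  unfolding tau3_def by (intro Max_ge finite_tau3_set) auto

lemma tau3_attained: "\<exists>c. almost_3_gallai n c \<and> tau3 n = card (rainbow_triangles n c)"
proof -
  have "almost_3_gallai n (\<lambda>_. 0)" unfolding almost_3_gallai_def rainbow_triangle_def by simp
  then have "{card (rainbow_triangles n c) | c. almost_3_gallai n c} \<noteq> {}" by blast
  from Max_in[OF finite_tau3_set this] show ?thesis unfolding tau3_def by auto
qed

theorem theorem1p2:
  shows "(\<forall>\<epsilon>>0. \<forall>\<^sub>F n in sequentially.
            (1/2 - \<epsilon>) * real n * log 2 (real n) \<le> real (tau3 n))
       \<and> (\<lambda>n. real (tau3 n)) \<in> O(\<lambda>n. real n powr sqrt 2 * log 2 (real n))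
       \<and> (\<forall>\<epsilon>>0. \<forall>\<^sub>F n in sequentially. \<exists>c. almost_3_gallai n c
            \<and> card (c ` Kn_edges n) \<le> 3
            \<and> (1/2 - \<epsilon>) * real n * log 2 (real n) \<le> real (card (rainbow_triangles n c)))"
proof (intro conjI)
  show three: "\<forall>\<epsilon>>0. \<forall>\<^sub>F n in sequentially. \<exists>c. almost_3_gallai n c
            \<and> card (c ` Kn_edges n) \<le> 3
            \<and> (1/2 - \<epsilon>) * real n * log 2 (real n) \<le> real (card (rainbow_triangles n c))"
  proof (intro allI impI)
    fix \<epsilon> :: real assume "\<epsilon> > 0"
    from half_n_log_n_eventually_le[OF this] eventually_ge_at_top[of 2]
    show "\<forall>\<^sub>F n in sequentially. \<exists>c. almost_3_gallai n c \<and> card (c ` Kn_edges n) \<le> 3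
            \<and> (1/2 - \<epsilon>) * real n * log 2 (real n) \<le> real (card (rainbow_triangles n c))"
      by eventually_elim (use exists_many_rainbow_three_colours order_trans in blast)
  qed
  show "\<forall>\<epsilon>>0. \<forall>\<^sub>F n in sequentially. (1/2 - \<epsilon>) * real n * log 2 (real n) \<le> real (tau3 n)"
  proof (intro allI impI)
    fix \<epsilon> :: real assume "\<epsilon> > 0"
    with three have "\<forall>\<^sub>F n in sequentially. \<exists>c. almost_3_gallai n c \<and> card (c ` Kn_edges n) \<le> 3
            \<and> (1/2 - \<epsilon>) * real n * log 2 (real n) \<le> real (card (rainbow_triangles n c))" by blast
    then show "\<forall>\<^sub>F n in sequentially. (1/2 - \<epsilon>) * real n * log 2 (real n) \<le> real (tau3 n)"
    proof eventually_elim
      case (elim n)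
      then show ?case using le_tau3 by (meson of_nat_le_iff order_trans)
    qed
  qed
  show "(\<lambda>n. real (tau3 n)) \<in> O(\<lambda>n. real n powr sqrt 2 * log 2 (real n))"
  proof (rule bigoI[where c = "32 * 10 ^ 10"])
    show "\<forall>\<^sub>F n in sequentially. norm (real (tau3 n)) \<le> 32 * 10 ^ 10 * norm (real n powr sqrt 2 * log 2 (real n))"
      using eventually_ge_at_top[of "2::nat"]
    proof eventually_elim
      case (elim n)
      obtain c where "almost_3_gallai n c" "tau3 n = card (rainbow_triangles n c)" using tau3_attained by blast
      then have "real (tau3 n) \<le> 32 * 10 ^ 10 * real n powr 1.4" using card_rainbow_triangles_le by simp
      \<comment> \<open>The exponent 1.4 is below \<open>sqrt 2\<close> because 1.96 < 2, and
        \<open>log 2 n \<ge> 1\<close> for \<open>n \<ge> 2\<close>.\<close>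
      also have "real n powr 1.4 \<le> real n powr sqrt 2 * log 2 (real n)"
      proof -
        have "1.4 \<le> sqrt 2" by (rule real_le_rsqrt) (simp add: power2_eq_square)
        then have "real n powr 1.4 \<le> real n powr sqrt 2" using elim by (intro powr_mono) auto
        also have "\<dots> \<le> real n powr sqrt 2 * log 2 (real n)"
          using elim mult_left_mono[of 1 "log 2 (real n)" "real n powr sqrt 2"] by simp
        finally show ?thesis .
      qed
      finally show ?case using elim by simp
    qed
  qed
qed

end
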